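(* Let $k\geq1$ be an integer. A self-similar measure on $\mathbb{R}^k$ has Fourier decay outside sparse frequencies if and only if it is affinely irreducible.
   Context: Fourier decay outside sparse frequencies: a probability measure $\mu$ on $\mathbb{R}^k$ has this property if for each $\epsilon>0$ there exist $\delta,C>0$ such that for all $R>1$, $$\bigl|\{\boldsymbol{\xi}\in\mathbb{R}^k:|\widehat{\mu}(\boldsymbol{\xi})|\geq R^{-\delta},\ |\boldsymbol{\xi}|<R\}\bigr|\leq CR^{\epsilon},$$ where the outer $|\cdot|$ on the left-hand side denotes Lebesgue measure on $\mathbb{R}^k$ and $\widehat{\mu}(\boldsymbol{\xi})=\int e^{-2\pi i\langle\boldsymbol{\xi},\mathbf{x}\rangle}\,d\mu(\mathbf{x})$. Affinely irreducible: $\mu(H)=0$ for every affine hyperplane $H\subset\mathbb{R}^k$. Self-similar measure: let $N>1$ be an integer, $r_1,\dotsc,r_N\in(0,1)$, $O_1,\dotsc,O_N\in O_k(\mathbb{R})$ orthogonal matrices, $\mathbf{t}_1,\dotsc,\mathbf{t}_N\in\mathbb{R}^k$, $g_i(\mathbf{x})=r_iO_i\mathbf{x}+\mathbf{t}_i$, and $p_1,\dotsc,p_N\in(0,1)$ with $\sum_i p_i=1$. The associated self-similar measure is the unique Borel probability measure $\mu$ on $\mathbb{R}^k$ with $\mu=\sum_i p_i\,\mu_{g_i}$, where $\mu_{g_i}(B)=\mu(g_i^{-1}(B))$. It is always assumed that the maps $g_i$ do not share a common fixed point. No separation condition is assumed. *)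

theory Defs
  imports "HOL-Probability.Probability"
begin

definition fourier_transform :: "(real ^ 'k) measure \<Rightarrow> real ^ 'k \<Rightarrow> complex" where
  "fourier_transform \<mu> \<xi> =
     (LINT x|\<mu>. exp (- 2 * complex_of_real pi * \<i> * complex_of_real (\<xi> \<bullet> x)))"

(* Intended for Borel probability measures, whose Fourier transform is continuous,
   so that the set of frequencies is Borel. *)
definition fourier_decay_outside_sparse :: "(real ^ 'k) measure \<Rightarrow> bool" where
  "fourier_decay_outside_sparse \<mu> \<longleftrightarrow>
     (\<forall>\<epsilon>>0. \<exists>\<delta>>0. \<exists>C>0. \<forall>R>1.
        emeasure lborel {\<xi>. cmod (fourier_transform \<mu> \<xi>) \<ge> R powr (- \<delta>) \<and> norm \<xi> < R}
          \<le> ennreal (C * R powr \<epsilon>))"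

definition affinely_irreducible :: "(real ^ 'k) measure \<Rightarrow> bool" where
  "affinely_irreducible \<mu> \<longleftrightarrow> (\<forall>a b. a \<noteq> 0 \<longrightarrow> emeasure \<mu> {x. a \<bullet> x = b} = 0)"

definition similarity_map :: "real \<Rightarrow> real ^ 'k ^ 'k \<Rightarrow> real ^ 'k \<Rightarrow> real ^ 'k \<Rightarrow> real ^ 'k" where
  "similarity_map r Q t x = r *\<^sub>R (Q *v x) + t"

(* By Hutchinson's theorem, the stationarity equation (the last conjunct) has exactly one
   solution among Borel probability measures for any given N, r, Q, t, p as below, so this
   says that \<mu> is the self-similar measure associated with some such data. *)
definition self_similar_measure :: "(real ^ 'k) measure \<Rightarrow> bool" where
  "self_similar_measure \<mu> \<longleftrightarrow>
     prob_space \<mu> \<and> sets \<mu> = sets borel \<and>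
     (\<exists>(N::nat) r Q t p.
        N > 1 \<and>
        (\<forall>i\<in>{1..N}. 0 < r i \<and> r i < 1) \<and>
        (\<forall>i\<in>{1..N}. orthogonal_matrix (Q i)) \<and>
        (\<forall>i\<in>{1..N}. 0 < p i \<and> p i < 1) \<and>
        (\<Sum>i=1..N. p i) = 1 \<and>
        \<not> (\<exists>x. \<forall>i\<in>{1..N}. similarity_map (r i) (Q i) (t i) x = x) \<and>
        (\<forall>B\<in>sets borel.
           measure \<mu> B =
             (\<Sum>i=1..N. p i * measure \<mu> (similarity_map (r i) (Q i) (t i) -` B))))"

end

theory Submission
  imports Defs
begin

text \<open>
  Both directions rest on elementary estimates for \<open>\<mu>\<close>, which is supported in a ball
  invariant under the maps. If \<open>\<mu>\<close> charges a hyperplane \<open>v \<bullet> x = b\<close>, a Fejer kernel along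
  the multiples of \<open>v\<close> shows that the Fourier transform \<open>F\<close> of \<open>\<mu>\<close> is bounded below near a positive
  proportion of them.

  Conversely, \<open>\<bar>F(\<xi>)\<bar>\<close> is replaced by the envelope \<open>A(\<xi>)\<close>, the supremum of
  \<open>\<bar>\<integral> e(-\<xi> \<bullet> x) f(x) d\<mu>(x)\<bar>\<close> over 1-Lipschitz \<open>f\<close> bounded by 1; it varies slowly even relative to
  its own size. Stopping the words at contraction ratio about \<open>\<rho>\<close> gives
  \<open>A(\<xi>)\<^sup>2 \<le> \<Sum> p\<^sub>w A(T\<^sub>w \<xi>)\<^sup>2\<close>. If this is nearly an equality at \<open>\<xi>\<close> and at \<open>\<xi> + \<zeta>\<close> with
  \<open>\<rho> \<bar>\<zeta>\<bar>\<close> small, then by strict convexity all the summands agree in modulus and phase at either point, so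
  \<open>x \<mapsto> e(\<zeta> \<bullet> x)\<close> is close to a 2-Lipschitz function on the support of \<open>\<mu>\<close>. Irreducibility,
  self-similarity and compactness of an annulus exclude this unless \<open>\<bar>\<zeta>\<bar>\<close> is bounded by a constant
  independent of \<open>\<rho>\<close>. Hence, for \<open>q\<close> large, the sum of \<open>A(\<xi>)\<^bsup>2q\<^esup>\<close> over separated points of norm at most \<open>R\<close>
  grows by a factor independent of \<open>\<rho>\<close> when \<open>R\<close> is multiplied by \<open>1/\<rho>\<close>, that is, like
  \<open>R\<^bsup>\<epsilon>\<^esup>\<close> if \<open>\<rho>\<close> is small.
\<close>

section \<open>Weighted means and separated sets\<close>

lemma variance_identity:
  fixes z :: "'a \<Rightarrow> complex" and p :: "'a \<Rightarrow> real"
  assumes p: "sum p W = 1" and m: "m = (\<Sum>w\<in>W. p w *\<^sub>R z w)"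
  shows "(\<Sum>w\<in>W. p w * (cmod (z w - m))\<^sup>2) = (\<Sum>w\<in>W. p w * (cmod (z w))\<^sup>2) - (cmod m)\<^sup>2"
proof -
  have e: "(cmod (z w - m))\<^sup>2 = (cmod (z w))\<^sup>2 - 2 * (z w \<bullet> m) + (cmod m)\<^sup>2" for w
    by (simp add: power2_norm_eq_inner inner_diff_left inner_diff_right inner_commute)
  have m2: "(\<Sum>w\<in>W. p w * (z w \<bullet> m)) = m \<bullet> m"
  proof -
    have "m \<bullet> m = (\<Sum>w\<in>W. p w *\<^sub>R z w) \<bullet> m"
      by (simp only: m[symmetric])
    also have "\<dots> = (\<Sum>w\<in>W. p w * (z w \<bullet> m))"
      by (simp only: inner_sum_left inner_scaleR_left)
    finally show ?thesis ..
  qed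
  have "(\<Sum>w\<in>W. p w * (cmod (z w - m))\<^sup>2) =
      (\<Sum>w\<in>W. p w * (cmod (z w))\<^sup>2 - 2 * (p w * (z w \<bullet> m)) + p w * (cmod m)\<^sup>2)"
    unfolding e by (intro sum.cong refl) (simp add: algebra_simps)
  also have "\<dots> = (\<Sum>w\<in>W. p w * (cmod (z w))\<^sup>2) - 2 * (m \<bullet> m) + (cmod m)\<^sup>2"
    by (simp only: sum.distrib sum_subtractf m2 p(1) sum_distrib_left[symmetric] sum_distrib_right[symmetric] mult_1)
  finally show ?thesis
    by (simp add: power2_norm_eq_inner)
qed

text \<open>Every weight is at least \<open>p0\<close>, so a single squared deviation is at most the
  variance divided by \<open>p0\<close>. \<open>B\<close> only bounds the second moment, so that one
  bound serves both the summands and the envelopes in \<open>near_optimal_coherent\<close>.\<close>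

lemma near_mean_if_variance_small:
  fixes z :: "'a \<Rightarrow> complex" and p :: "'a \<Rightarrow> real"
  assumes W: "finite W" and p: "sum p W = 1" "\<And>w. w \<in> W \<Longrightarrow> p0 \<le> p w" and "p0 > 0"
    and m: "m = (\<Sum>w\<in>W. p w *\<^sub>R z w)" and "w \<in> W"
    and "(\<Sum>w\<in>W. p w * (cmod (z w))\<^sup>2) \<le> B" "B - (cmod m)\<^sup>2 \<le> p0 * (\<tau> * Q)\<^sup>2" "\<tau> \<ge> 0" "Q \<ge> 0"
  shows "cmod (z w - m) \<le> \<tau> * Q"
proof -
  have "p0 * (cmod (z w - m))\<^sup>2 \<le> p w * (cmod (z w - m))\<^sup>2"
    using p \<open>w \<in> W\<close> by (intro mult_right_mono) auto
  also have "\<dots> \<le> (\<Sum>w\<in>W. p w * (cmod (z w - m))\<^sup>2)"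
  proof (intro member_le_sum W \<open>w \<in> W\<close> mult_nonneg_nonneg zero_le_power2)
    show "0 \<le> p v" if "v \<in> W - {w}" for v
      using p(2)[of v] \<open>p0 > 0\<close> that by simp
  qed
  also have "\<dots> \<le> p0 * (\<tau> * Q)\<^sup>2"
    using assms(7,8) variance_identity[OF p(1) m] by linarith
  finally have "(cmod (z w - m))\<^sup>2 \<le> (\<tau> * Q)\<^sup>2"
    using \<open>p0 > 0\<close> by simp
  moreover have "0 \<le> \<tau> * Q"
    using assms by simp
  ultimately show ?thesis
    by (rule power2_le_imp_le)
qed

text \<open>Jensen's inequality. The exponent 2 compares mean and root mean square, a general
  exponent passes to higher moments.\<close>

lemma weighted_power_mean:
  fixes x p :: "'a \<Rightarrow> real"
  assumes "finite W" "sum p W = 1" "\<And>w. w \<in> W \<Longrightarrow> 0 \<le> p w" "\<And>w. w \<in> W \<Longrightarrow> 0 \<le> x w"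
  shows "(\<Sum>w\<in>W. p w * x w) ^ q \<le> (\<Sum>w\<in>W. p w * x w ^ q)"
proof -
  have "W \<noteq> {}" using assms(2) by auto
  have "convex_on {0..} (\<lambda>x::real. x ^ q)"
    by (cases "even q") (auto intro: convex_power_odd convex_on_subset[OF convex_power_even])
  then have "(\<lambda>x. x ^ q) (\<Sum>w\<in>W. p w *\<^sub>R x w) \<le> (\<Sum>w\<in>W. p w * x w ^ q)"
    using assms \<open>W \<noteq> {}\<close> by (intro convex_on_sum[where C = "{0..}"]) auto
  then show ?thesis by simp
qed

text \<open>Packing: the balls of radius \<open>\<sigma> / 2\<close> about the points are disjoint
  and lie in a ball of radius \<open>R + \<sigma> / 2\<close>; compare volumes.\<close>

lemma separated_card_le:
  fixes E :: "'a::euclidean_space set"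
  assumes "finite E" "E \<subseteq> cball c R" "0 < \<sigma>" "0 \<le> R"
    and sep: "\<And>x y. x \<in> E \<Longrightarrow> y \<in> E \<Longrightarrow> x \<noteq> y \<Longrightarrow> \<sigma> \<le> dist x y"
  shows "real (card E) \<le> (1 + 2 * R / \<sigma>) ^ DIM('a)"
proof -
  define V where "V = unit_ball_vol (real DIM('a))"
  have V: "V > 0" by (simp add: V_def)
  have disj: "disjoint_family_on (\<lambda>x. ball x (\<sigma>/2)) E"
  proof (unfold disjoint_family_on_def, intro ballI impI)
    fix x y assume "x \<in> E" "y \<in> E" "x \<noteq> y"
    then have "\<sigma> \<le> dist x y" by (rule sep)
    then show "ball x (\<sigma>/2) \<inter> ball y (\<sigma>/2) = {}"
      by (intro disjoint_ballI) auto
  qed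
  have "measure lebesgue (\<Union>x\<in>E. ball x (\<sigma>/2)) = (\<Sum>x\<in>E. measure lebesgue (ball x (\<sigma>/2)))"
    using disj assms by (intro measure_finite_Union) (use emeasure_lborel_ball_finite in \<open>auto simp: less_top\<close>)
  also have "\<dots> = card E * (V * (\<sigma>/2) ^ DIM('a))"
    using assms by (simp add: content_ball V_def)
  finally have "card E * (V * (\<sigma>/2) ^ DIM('a)) = measure lebesgue (\<Union>x\<in>E. ball x (\<sigma>/2))" ..
  also have "\<dots> \<le> measure lebesgue (cball c (R + \<sigma>/2))"
  proof (rule measure_mono_fmeasurable)
    show "(\<Union>x\<in>E. ball x (\<sigma>/2)) \<subseteq> cball c (R + \<sigma>/2)"
    proof safe
      fix x y assume "x \<in> E" "y \<in> ball x (\<sigma>/2)"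
      then have "dist c x \<le> R" "dist x y < \<sigma>/2" using assms by auto
      then show "y \<in> cball c (R + \<sigma>/2)" using dist_triangle[of c y x] by simp
    qed
    show "(\<Union>x\<in>E. ball x (\<sigma>/2)) \<in> sets lebesgue"
      using assms(1) by (intro sets.finite_UN) auto
  qed auto
  also have "\<dots> = V * (R + \<sigma>/2) ^ DIM('a)"
    using assms by (simp add: content_cball V_def)
  finally have "real (card E) * (\<sigma>/2) ^ DIM('a) \<le> (R + \<sigma>/2) ^ DIM('a)"
    using V by (simp add: mult.left_commute)
  then have "real (card E) \<le> ((R + \<sigma>/2) / (\<sigma>/2)) ^ DIM('a)"
    unfolding power_divide[of "R + \<sigma>/2"] using assms by (subst pos_le_divide_eq) auto
  also have "(R + \<sigma>/2) / (\<sigma>/2) = 1 + 2 * R / \<sigma>"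
    using assms by (simp add: field_simps)
  finally show ?thesis .
qed

text \<open>Greedy selection: keep a point where \<open>f\<close> is largest and discard its \<open>s\<close>-ball.\<close>
lemma separated_subset_captures_sum:
  fixes E :: "'a::metric_space set" and f :: "'a \<Rightarrow> real"
  assumes "finite E" "\<And>x. x \<in> E \<Longrightarrow> real (card {y\<in>E. dist x y < s}) \<le> D" "\<And>x. x \<in> E \<Longrightarrow> 0 \<le> f x" "0 < s"
  shows "\<exists>E'\<subseteq>E. (\<forall>x\<in>E'. \<forall>y\<in>E'. x \<noteq> y \<longrightarrow> s \<le> dist x y) \<and> sum f E \<le> D * sum f E'"
  using assms(1-3)
proof (induction E rule: finite_psubset_induct)
  case (psubset E)
  show ?case
  proof (cases "E = {}")
    case False
    obtain x where x: "x \<in> E" "\<And>y. y \<in> E \<Longrightarrow> f y \<le> f x"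
    proof -
      have "Max (f ` E) \<in> f ` E"
        using psubset.hyps(1) False by (intro Max_in) auto
      then obtain x where "x \<in> E" "Max (f ` E) = f x"
        by blast
      moreover have "f y \<le> Max (f ` E)" if "y \<in> E" for y
        using psubset.hyps(1) that by (intro Max_ge) auto
      ultimately show ?thesis
        by (intro that[of x]) auto
    qed
    define E1 where "E1 = {y\<in>E. s \<le> dist x y}"
    define E2 where "E2 = {y\<in>E. dist x y < s}"
    have E: "E = E1 \<union> E2" "E1 \<inter> E2 = {}" by (auto simp: E1_def E2_def)
    have fin: "finite E1" "finite E2" using psubset.hyps(1) by (auto simp: E1_def E2_def)
    have "x \<in> E2" using x assms(4) by (simp add: E2_def)
    then have sub: "E1 \<subset> E" using E by auto
    have dens: "real (card {y\<in>E1. dist z y < s}) \<le> D" if "z \<in> E1" for z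
    proof -
      have "card {y\<in>E1. dist z y < s} \<le> card {y\<in>E. dist z y < s}"
        using psubset.hyps(1) E by (intro card_mono) auto
      moreover have "z \<in> E" using that E by auto
      ultimately show ?thesis using psubset.prems(1)[of z] by linarith
    qed
    have "0 \<le> f z" if "z \<in> E1" for z
      using psubset.prems(2) that E by auto
    with dens obtain E' where E': "E' \<subseteq> E1" "\<forall>x\<in>E'. \<forall>y\<in>E'. x \<noteq> y \<longrightarrow> s \<le> dist x y" "sum f E1 \<le> D * sum f E'"
      using psubset.IH[OF sub] by blast
    have "sum f E = sum f E1 + sum f E2"
      unfolding E using E(2) fin by (intro sum.union_disjoint)
    moreover have "sum f E2 \<le> D * f x"
    proof -
      have "sum f E2 \<le> real (card E2) * f x"
        using x(2) E by (intro sum_bounded_above) auto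
      also have "\<dots> \<le> D * f x"
        using psubset.prems(1)[OF x(1)] psubset.prems(2)[OF x(1)] by (intro mult_right_mono) (auto simp: E2_def)
      finally show ?thesis .
    qed
    moreover have "x \<notin> E'" using E'(1) assms(4) by (auto simp: E1_def)
    moreover have "finite E'" using E'(1) fin(1) by (rule finite_subset)
    ultimately have "sum f E \<le> D * sum f (insert x E')"
      using E'(3) by (simp add: algebra_simps)
    moreover have "insert x E' \<subseteq> E" using E'(1) E x(1) by auto
    moreover have "\<forall>y\<in>insert x E'. \<forall>z\<in>insert x E'. y \<noteq> z \<longrightarrow> s \<le> dist y z"
      using E'(1,2) by (auto simp: E1_def dist_commute)
    ultimately show ?thesis by blast
  qed auto
qed

text \<open>A contracting linear map turns an \<open>s\<close>-separated set into a less separated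
  one. Thinning it out restores the separation \<open>s\<close>, at the cost of the number of
  \<open>\<sigma>\<close>-separated points that fit in an \<open>s\<close>-ball.\<close>

lemma separated_transfer:
  fixes E :: "'a::euclidean_space set" and f :: "'a \<Rightarrow> real"
  assumes "finite E" "E \<subseteq> X" "0 < \<sigma>" "0 < s" "\<And>x. 0 \<le> f x"
    and sep: "\<And>x y. x \<in> E \<Longrightarrow> y \<in> E \<Longrightarrow> x \<noteq> y \<Longrightarrow> \<sigma> \<le> dist x y"
    and bd: "\<And>E'. finite E' \<Longrightarrow> E' \<subseteq> X \<Longrightarrow> (\<forall>x\<in>E'. \<forall>y\<in>E'. x \<noteq> y \<longrightarrow> s \<le> dist x y) \<Longrightarrow> sum f E' \<le> B"
  shows "sum f E \<le> (1 + 2 * s / \<sigma>) ^ DIM('a) * B"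
proof -
  have "real (card {y\<in>E. dist x y < s}) \<le> (1 + 2 * s / \<sigma>) ^ DIM('a)" if "x \<in> E" for x
    using assms by (intro separated_card_le[where c=x]) auto
  then obtain E' where E': "E'\<subseteq>E" "\<forall>x\<in>E'. \<forall>y\<in>E'. x \<noteq> y \<longrightarrow> s \<le> dist x y"
      "sum f E \<le> (1 + 2 * s / \<sigma>) ^ DIM('a) * sum f E'"
    using separated_subset_captures_sum[of E s "(1 + 2 * s / \<sigma>) ^ DIM('a)" f] assms by blast
  have "sum f E' \<le> B"
    using E' assms(1,2) by (intro bd) (auto intro: finite_subset)
  then have "(1 + 2 * s / \<sigma>) ^ DIM('a) * sum f E' \<le> (1 + 2 * s / \<sigma>) ^ DIM('a) * B"
    using assms by (intro mult_left_mono) auto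
  with E'(3) show ?thesis by linarith
qed

text \<open>A separated subset of maximal cardinality is an \<open>s\<close>-net, so its
  \<open>s\<close>-balls cover \<open>S\<close>.\<close>

lemma emeasure_le_separated_card:
  fixes S :: "'a::euclidean_space set"
  assumes "S \<subseteq> cball 0 R" "0 < s" "0 \<le> R"
    and bd: "\<And>E. finite E \<Longrightarrow> E \<subseteq> S \<Longrightarrow> (\<forall>x\<in>E. \<forall>y\<in>E. x \<noteq> y \<longrightarrow> s \<le> dist x y) \<Longrightarrow> real (card E) \<le> B"
  shows "emeasure lborel S \<le> ennreal (B * measure lebesgue (cball (0::'a) s))"
proof -
  define P where "P E \<longleftrightarrow> finite E \<and> E \<subseteq> S \<and> (\<forall>x\<in>E. \<forall>y\<in>E. x \<noteq> y \<longrightarrow> s \<le> dist x y)" for E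
  have "P {}" by (simp add: P_def)
  moreover have "card E < Suc (nat \<lceil>B\<rceil>)" if "P E" for E
    using bd[of E] that by (simp add: P_def le_imp_less_Suc le_nat_iff) linarith
  ultimately have "\<exists>E. P E \<and> (\<forall>F. P F \<longrightarrow> card F \<le> card E)"
    by (intro ex_has_greatest_nat[of P "{}" card "Suc (nat \<lceil>B\<rceil>)"]) auto
  then obtain E where E: "P E" "\<And>F. P F \<Longrightarrow> card F \<le> card E" by blast
  have "S \<subseteq> (\<Union>x\<in>E. cball x s)"
  proof
    fix y assume y: "y \<in> S"
    show "y \<in> (\<Union>x\<in>E. cball x s)"
    proof (rule ccontr)
      assume "y \<notin> (\<Union>x\<in>E. cball x s)"
      then have far: "\<And>x. x \<in> E \<Longrightarrow> s < dist x y" by auto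
      then have "P (insert y E)" using E(1) y by (force simp: P_def dist_commute)
      then have "card (insert y E) \<le> card E" by (rule E)
      moreover have "y \<notin> E" using far[of y] assms by auto
      ultimately show False using E(1) by (simp add: P_def)
    qed
  qed
  then have "emeasure lborel S \<le> emeasure lborel (\<Union>x\<in>E. cball x s)"
    using E(1) by (intro emeasure_mono) (auto simp: P_def)
  also have "\<dots> \<le> (\<Sum>x\<in>E. emeasure lborel (cball x s))"
    using E(1) by (intro emeasure_subadditive_finite) (auto simp: P_def)
  also have "\<dots> = (\<Sum>x\<in>E. ennreal (measure lebesgue (cball (0::'a) s)))"
    using assms by (intro sum.cong refl) (simp add: emeasure_cball content_cball)
  also have "\<dots> = ennreal (real (card E) * measure lebesgue (cball (0::'a) s))"
    by (simp add: ennreal_mult'' ennreal_of_nat_eq_real_of_nat)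
  also have "\<dots> \<le> ennreal (B * measure lebesgue (cball (0::'a) s))"
    using bd[of E] E(1) by (intro ennreal_leI mult_right_mono) (auto simp: P_def)
  finally show ?thesis .
qed

section \<open>Families of similarities leaving a measure stationary\<close>

text \<open>Stationarity on sets says that \<open>\<mu>\<close> is a mixture of its images, that is,
  a monadic bind. Nonnegative functions come first, then real ones by adding a constant, then real
  and imaginary parts.\<close>

lemma integral_stationary:
  fixes f :: "'a \<Rightarrow> complex" and I :: "'i pmf"
  assumes "prob_space \<mu>" and fin: "finite (set_pmf I)" and g: "\<And>i. g i \<in> measurable \<mu> \<mu>"
    and st: "\<And>B. B \<in> sets \<mu> \<Longrightarrow>
      measure \<mu> B = (\<Sum>i\<in>set_pmf I. pmf I i * measure \<mu> (g i -` B \<inter> space \<mu>))"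
    and f: "f \<in> borel_measurable \<mu>" "\<And>x. cmod (f x) \<le> C"
  shows "(LINT x|\<mu>. f x) = (LINT i|measure_pmf I. LINT x|\<mu>. f (g i x))"
proof -
  interpret prob_space \<mu> by fact
  define k where "k i = distr \<mu> \<mu> (g i)" for i
  have k: "k \<in> measurable (measure_pmf I) (subprob_algebra \<mu>)"
    unfolding measurable_pmf_measure1
    by (auto simp: k_def space_subprob_algebra intro!: prob_space_imp_subprob_space prob_space_distr g)
  have bind: "\<mu> = measure_pmf I \<bind> k"
  proof (rule measure_eqI)
    show "sets \<mu> = sets (measure_pmf I \<bind> k)"
      by (rule sets_bind[symmetric, where N=\<mu>]) (auto simp: k_def)
    fix B assume B: "B \<in> sets \<mu>"
    have "emeasure (measure_pmf I \<bind> k) B = (\<Sum>i\<in>set_pmf I. emeasure (k i) B * pmf I i)"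
      by (subst emeasure_bind[OF _ k B]) (simp_all add: nn_integral_measure_pmf_finite fin)
    also have "\<dots> = (\<Sum>i\<in>set_pmf I. ennreal (pmf I i * measure \<mu> (g i -` B \<inter> space \<mu>)))"
      using g B by (intro sum.cong refl) (simp add: k_def emeasure_distr emeasure_eq_measure ennreal_mult mult.commute)
    also have "\<dots> = emeasure \<mu> B"
      by (simp add: emeasure_eq_measure st[OF B])
    finally show "emeasure \<mu> B = emeasure (measure_pmf I \<bind> k) B" ..
  qed
  have fing: "(\<lambda>x. f (g i x)) \<in> borel_measurable \<mu>" for i
    using measurable_compose[OF g f(1)] .
  have nonneg: "(LINT x|\<mu>. h x) = (\<Sum>i\<in>set_pmf I. pmf I i * (LINT x|\<mu>. h (g i x)))"
    if h: "h \<in> borel_measurable \<mu>" "\<And>x. 0 \<le> h x" "\<And>x. h x \<le> c" for h :: "'a \<Rightarrow> real" and c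
  proof -
    have hg: "(\<lambda>x. h (g i x)) \<in> borel_measurable \<mu>" for i
      using measurable_compose[OF g h(1)] .
    have int: "integrable \<mu> h" "integrable \<mu> (\<lambda>x. h (g i x))" for i
      using h hg by (auto intro!: integrable_const_bound[where B=c])
    have "ennreal (LINT x|\<mu>. h x) = (\<integral>\<^sup>+x. h x \<partial>\<mu>)"
      using int h by (simp add: nn_integral_eq_integral)
    also have "\<dots> = (\<integral>\<^sup>+i. \<integral>\<^sup>+x. h x \<partial>k i \<partial>measure_pmf I)"
      using h by (subst bind, subst nn_integral_bind[OF _ k]) auto
    also have "\<dots> = (\<integral>\<^sup>+i. ennreal (LINT x|\<mu>. h (g i x)) \<partial>measure_pmf I)"
      using int h g by (simp add: k_def nn_integral_distr nn_integral_eq_integral)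
    also have "\<dots> = ennreal (\<Sum>i\<in>set_pmf I. pmf I i * (LINT x|\<mu>. h (g i x)))"
      using h by (simp add: nn_integral_measure_pmf_finite fin mult.commute flip: ennreal_mult'' sum_ennreal)
    finally show ?thesis
      using h by (subst (asm) ennreal_inj) (auto intro!: sum_nonneg)
  qed
  have real: "(LINT x|\<mu>. h x) = (\<Sum>i\<in>set_pmf I. pmf I i * (LINT x|\<mu>. h (g i x)))"
    if h: "h \<in> borel_measurable \<mu>" "\<And>x. \<bar>h x\<bar> \<le> C" for h :: "'a \<Rightarrow> real"
  proof -
    have hg: "(\<lambda>x. h (g i x)) \<in> borel_measurable \<mu>" for i
      using measurable_compose[OF g h(1)] .
    have int: "integrable \<mu> h" "integrable \<mu> (\<lambda>x. h (g i x))" for i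
      using h hg by (auto intro!: integrable_const_bound[where B=C])
    have "0 \<le> h x + C" "h x + C \<le> 2 * C" for x
      using h(2)[of x] by auto
    then have "(LINT x|\<mu>. h x + C) = (\<Sum>i\<in>set_pmf I. pmf I i * (LINT x|\<mu>. h (g i x) + C))"
      using h by (intro nonneg[of "\<lambda>x. h x + C" "2 * C"]) auto
    then show ?thesis
      using int by (simp add: prob_space distrib_left sum.distrib sum_pmf_eq_1 fin flip: sum_distrib_right)
  qed
  have int: "integrable \<mu> f" "integrable \<mu> (\<lambda>x. f (g i x))" for i
    using f fing by (auto intro!: integrable_const_bound[where B=C])
  have "(LINT x|\<mu>. f x) = (\<Sum>i\<in>set_pmf I. pmf I i *\<^sub>R (LINT x|\<mu>. f (g i x)))"
  proof (rule complex_eqI)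
    have "\<bar>Re (f x)\<bar> \<le> C" "\<bar>Im (f x)\<bar> \<le> C" for x
      using f(2)[of x] abs_Re_le_cmod[of "f x"] abs_Im_le_cmod[of "f x"] by linarith+
    then have "(LINT x|\<mu>. Re (f x)) = (\<Sum>i\<in>set_pmf I. pmf I i * (LINT x|\<mu>. Re (f (g i x))))"
      "(LINT x|\<mu>. Im (f x)) = (\<Sum>i\<in>set_pmf I. pmf I i * (LINT x|\<mu>. Im (f (g i x))))"
      using f by (auto intro!: real)
    then show "Re (LINT x|\<mu>. f x) = Re (\<Sum>i\<in>set_pmf I. pmf I i *\<^sub>R (LINT x|\<mu>. f (g i x)))"
      "Im (LINT x|\<mu>. f x) = Im (\<Sum>i\<in>set_pmf I. pmf I i *\<^sub>R (LINT x|\<mu>. f (g i x)))"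
      using int by simp_all
  qed
  then show ?thesis
    by (subst integral_measure_pmf[of "set_pmf I"]) (auto simp: fin)
qed

section \<open>Similitudes and the construction of stationary families\<close>

lemma borel_measurable_affine:
  fixes M :: "real ^ 'k ^ 'k"
  shows "(\<lambda>x. M *v x + t) \<in> borel_measurable borel"
  by (intro borel_measurable_continuous_onI continuous_intros matrix_vector_mult_linear_continuous_on)

text \<open>Points are moved by \<open>M\<close> and frequencies by its transpose, hence both
  conditions. For \<open>r > 0\<close> these are the multiples by \<open>r\<close> of orthogonal
  matrices.\<close>

definition similitude :: "real \<Rightarrow> real ^ 'k ^ 'k \<Rightarrow> bool" where
  "similitude r M \<longleftrightarrow> (\<forall>x. norm (M *v x) = r * norm x) \<and> (\<forall>x. norm (x v* M) = r * norm x)"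

lemma similitude_orthogonal:
  fixes Q :: "real ^ 'k ^ 'k"
  assumes "orthogonal_matrix Q" "0 \<le> r"
  shows "similitude r (r *\<^sub>R Q)"
proof -
  have norm: "norm (A *v x) = norm x" if "orthogonal_matrix A" for A :: "real^'k^'k" and x
    using that orthogonal_transformation_matrix[of "(*v) A"] orthogonal_transformation_norm[of "(*v) A"]
    by simp
  have "norm (x v* Q) = norm x" for x
    using norm[of "transpose Q" x] assms by simp
  then show ?thesis
    using norm assms by (simp add: similitude_def vector_scaleR_matrix_ac flip: scaleR_matrix_vector_assoc)
qed

lemma similitude_mult:
  assumes "similitude r M" "similitude s L"
  shows "similitude (r * s) (M ** L)"
  using assms by (simp add: similitude_def flip: matrix_vector_mul_assoc vector_matrix_mul_assoc)

lemma similitude_1: "similitude 1 (mat 1)"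
  by (simp add: similitude_def)

text \<open>The maps of the family are encoded as pairs of a linear part and a translation,
  weighted by a probability mass function; equal maps are merged.\<close>
definition stationary_family ::
  "(real ^ 'k) measure \<Rightarrow> real \<Rightarrow> real \<Rightarrow> real \<Rightarrow> ((real ^ 'k ^ 'k) \<times> (real ^ 'k)) pmf \<Rightarrow> bool" where
  "stationary_family \<mu> K a b D \<longleftrightarrow>
     finite (set_pmf D) \<and>
     (\<forall>w\<in>set_pmf D. (\<exists>r. a < r \<and> r \<le> b \<and> similitude r (fst w)) \<and>
        (\<forall>x\<in>cball 0 K. fst w *v x + snd w \<in> cball 0 K)) \<and>
     (\<forall>f::real ^ 'k \<Rightarrow> complex. f \<in> borel_measurable borel \<longrightarrow> (\<exists>C. \<forall>x\<in>cball 0 K. cmod (f x) \<le> C) \<longrightarrow>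
        (LINT x|\<mu>. f x) = (LINT w|measure_pmf D. LINT x|\<mu>. f (fst w *v x + snd w)))"

text \<open>Concatenation: a first letter \<open>i\<close> is followed by a word from a family that
  may depend on \<open>i\<close>. Ratios multiply, so the family after \<open>i\<close> has to live
  at scales divided by \<open>r i\<close>.\<close>

lemma stationary_family_compose:
  fixes \<mu> :: "(real ^ 'k) measure"
  assumes fin: "finite (set_pmf I)"
    and g: "\<And>i. i \<in> set_pmf I \<Longrightarrow> 0 < r i \<and> similitude (r i) (M i)"
      "\<And>i x. i \<in> set_pmf I \<Longrightarrow> x \<in> cball 0 K \<Longrightarrow> M i *v x + t i \<in> cball 0 K"
    and st: "\<And>f::real ^ 'k \<Rightarrow> complex. f \<in> borel_measurable borel \<Longrightarrow> (\<exists>C. \<forall>x\<in>cball 0 K. cmod (f x) \<le> C) \<Longrightarrow>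
        (LINT x|\<mu>. f x) = (LINT i|measure_pmf I. LINT x|\<mu>. f (M i *v x + t i))"
    and D: "\<And>i. i \<in> set_pmf I \<Longrightarrow> stationary_family \<mu> K (a / r i) (b / r i) (D i)"
  shows "stationary_family \<mu> K a b
    (bind_pmf I (\<lambda>i. map_pmf (\<lambda>w. (M i ** fst w, M i *v snd w + t i)) (D i)))"
    (is "stationary_family \<mu> K a b ?E")
proof -
  have set: "set_pmf ?E = (\<Union>i\<in>set_pmf I. (\<lambda>w. (M i ** fst w, M i *v snd w + t i)) ` set_pmf (D i))"
    by simp
  have finD: "\<And>i. i \<in> set_pmf I \<Longrightarrow> finite (set_pmf (D i))"
    using D by (simp add: stationary_family_def)
  have "(\<exists>r'. a < r' \<and> r' \<le> b \<and> similitude r' (fst v)) \<and> (\<forall>x\<in>cball 0 K. fst v *v x + snd v \<in> cball 0 K)"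
    if "v \<in> set_pmf ?E" for v
  proof -
    from that obtain i w where i: "i \<in> set_pmf I" and w: "w \<in> set_pmf (D i)"
      and v: "fst v = M i ** fst w" "snd v = M i *v snd w + t i"
      unfolding set by auto
    have "(\<exists>r'. a / r i < r' \<and> r' \<le> b / r i \<and> similitude r' (fst w)) \<and>
        (\<forall>x\<in>cball 0 K. fst w *v x + snd w \<in> cball 0 K)"
      using D[OF i] w unfolding stationary_family_def by blast
    then obtain s where s: "a / r i < s" "s \<le> b / r i" "similitude s (fst w)"
      and inv: "\<And>x. x \<in> cball 0 K \<Longrightarrow> fst w *v x + snd w \<in> cball 0 K"
      by blast
    have "similitude (r i * s) (fst v)"
      using s g(1)[OF i] by (auto simp: v intro: similitude_mult)
    moreover have "a < r i * s" "r i * s \<le> b"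
      using s g(1)[OF i] by (auto simp: field_simps)
    moreover have "fst v *v x + snd v = M i *v (fst w *v x + snd w) + t i" for x
      by (simp add: v matrix_vector_mul_assoc matrix_vector_right_distrib)
    ultimately show ?thesis
      using g(2)[OF i inv] by auto
  qed
  moreover have "(LINT x|\<mu>. f x) = (LINT w|measure_pmf ?E. LINT x|\<mu>. f (fst w *v x + snd w))"
    if f: "f \<in> borel_measurable borel" "\<exists>C. \<forall>x\<in>cball 0 K. cmod (f x) \<le> C" for f :: "real ^ 'k \<Rightarrow> complex"
  proof -
    have step: "(LINT x|\<mu>. f (M i *v x + t i)) =
        (LINT w|measure_pmf (map_pmf (\<lambda>w. (M i ** fst w, M i *v snd w + t i)) (D i)). LINT x|\<mu>. f (fst w *v x + snd w))"
      if i: "i \<in> set_pmf I" for i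
    proof -
      have "(\<lambda>x. f (M i *v x + t i)) \<in> borel_measurable borel"
        by (rule measurable_compose[OF borel_measurable_affine f(1)])
      moreover have "\<exists>C. \<forall>x\<in>cball 0 K. cmod (f (M i *v x + t i)) \<le> C"
        using f(2) g(2)[OF i] by blast
      ultimately have "(LINT x|\<mu>. f (M i *v x + t i)) =
          (LINT w|measure_pmf (D i). LINT x|\<mu>. f (M i *v (fst w *v x + snd w) + t i))"
        using D[OF i] unfolding stationary_family_def by blast
      then show ?thesis
        by (simp add: matrix_vector_mul_assoc matrix_vector_right_distrib add.assoc)
    qed
    have "(LINT x|\<mu>. f x) = (\<Sum>i\<in>set_pmf I. pmf I i *\<^sub>R (LINT x|\<mu>. f (M i *v x + t i)))"
      unfolding st[OF f] by (subst integral_measure_pmf[of "set_pmf I"]) (auto simp: fin)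
    also have "\<dots> = (LINT w|measure_pmf ?E. LINT x|\<mu>. f (fst w *v x + snd w))"
      by (subst pmf_expectation_bind[OF fin]) (auto simp: finD step simp del: integral_map_pmf)
    finally show ?thesis .
  qed
  moreover have "finite (set_pmf ?E)"
    unfolding set using fin finD by blast
  ultimately show ?thesis
    unfolding stationary_family_def by blast
qed

text \<open>Words are stopped as soon as their contraction ratio drops to \<open>\<rho>\<close>; the induction is on
  the number of letters needed for that.\<close>
lemma stationary_family_stopping:
  fixes \<mu> :: "(real ^ 'k) measure"
  assumes fin: "finite (set_pmf I)" and ab: "0 < a" "a \<le> 1" "0 < b" "b < 1"
    and g: "\<And>i. i \<in> set_pmf I \<Longrightarrow> a < r i \<and> r i \<le> b \<and> similitude (r i) (M i)"
      "\<And>i x. i \<in> set_pmf I \<Longrightarrow> x \<in> cball 0 K \<Longrightarrow> M i *v x + t i \<in> cball 0 K"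
    and st: "\<And>f::real ^ 'k \<Rightarrow> complex. f \<in> borel_measurable borel \<Longrightarrow> (\<exists>C. \<forall>x\<in>cball 0 K. cmod (f x) \<le> C) \<Longrightarrow>
        (LINT x|\<mu>. f x) = (LINT i|measure_pmf I. LINT x|\<mu>. f (M i *v x + t i))"
    and \<rho>: "0 < \<rho>" "\<rho> < 1 / a"
  shows "\<exists>D. stationary_family \<mu> K (a * \<rho>) \<rho> D"
proof -
  \<comment> \<open>The empty word: its ratio 1 lies in the window above \<open>a * \<rho>\<close>
    and up to \<open>\<rho>\<close>.\<close>
  have unit: "\<exists>D. stationary_family \<mu> K (a * \<rho>) \<rho> D" if "1 \<le> \<rho>" "\<rho> < 1 / a" for \<rho>
  proof -
    have "a * \<rho> < 1" using that ab by (simp add: field_simps)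
    then have "stationary_family \<mu> K (a * \<rho>) \<rho> (return_pmf (mat 1, 0))"
      using that similitude_1
      by (auto simp: stationary_family_def integral_measure_pmf[of "{(mat 1, 0)}"])
    then show ?thesis ..
  qed
  have "\<exists>D. stationary_family \<mu> K (a * \<rho>) \<rho> D" if "b ^ n \<le> \<rho>" "0 < \<rho>" "\<rho> < 1 / a" for n \<rho>
    using that
  proof (induction n arbitrary: \<rho>)
    case 0
    then show ?case by (intro unit) auto
  next
    case (Suc n)
    show ?case
    proof (cases "1 \<le> \<rho>")
      case False
      have "\<exists>D. stationary_family \<mu> K (a * \<rho> / r i) (\<rho> / r i) D" if i: "i \<in> set_pmf I" for i
      proof -
        have r: "a < r i" "r i \<le> b" using g(1)[OF i] by auto
        have "b ^ n \<le> \<rho> / b"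
          using Suc.prems(1) ab by (simp add: field_simps)
        also have "\<dots> \<le> \<rho> / r i"
          using r ab Suc.prems by (intro divide_left_mono) auto
        finally have "b ^ n \<le> \<rho> / r i" .
        moreover have "0 < \<rho> / r i" using r ab Suc.prems by simp
        \<comment> \<open>After a letter the target may exceed 1, but since \<open>a < r i\<close>
          it stays below \<open>1 / a\<close>. This is why the claim is made for all
          \<open>\<rho> < 1 / a\<close> and not only up to 1.\<close>
        moreover have "\<rho> / r i < 1 / a"
          using r ab Suc.prems False by (simp add: field_simps) (smt (verit) mult_less_cancel_right1)
        ultimately show ?thesis
          using Suc.IH[of "\<rho> / r i"] by simp
      qed
      then obtain D where "\<And>i. i \<in> set_pmf I \<Longrightarrow> stationary_family \<mu> K (a * \<rho> / r i) (\<rho> / r i) (D i)"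
        by metis
      moreover have "0 < r i \<and> similitude (r i) (M i)" if "i \<in> set_pmf I" for i
        using g(1)[OF that] ab(1) by simp
      ultimately show ?thesis
        using stationary_family_compose[of I r M K t, OF fin _ g(2) st] by blast
    qed (use Suc.prems unit in auto)
  qed
  moreover obtain n where "b ^ n \<le> \<rho>"
    using real_arch_pow_inv[of \<rho> b] \<rho> ab less_imp_le by blast
  ultimately show ?thesis using \<rho> by blast
qed

text \<open>Points mapped outside a ball come from outside a larger one, so the tail mass satisfies
  \<open>\<phi> (K0 + d) \<le> \<phi> (K0 + d / b)\<close>. Iterating pushes the radius to infinity,
  so the tail vanishes.\<close>

lemma self_similar_measure_support:
  fixes \<mu> :: "(real ^ 'k) measure" and N :: nat
  assumes "prob_space \<mu>" and sets: "sets \<mu> = sets borel"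
    and r: "\<And>i. i \<in> {1..N} \<Longrightarrow> 0 < r i \<and> r i \<le> b" and b: "0 < b" "b < 1"
    and Q: "\<And>i. i \<in> {1..N} \<Longrightarrow> orthogonal_matrix (Q i)"
    and p: "\<And>i. i \<in> {1..N} \<Longrightarrow> 0 < p i" "(\<Sum>i=1..N. p i) = 1"
    and st: "\<And>B. B \<in> sets borel \<Longrightarrow> measure \<mu> B =
             (\<Sum>i=1..N. p i * measure \<mu> (similarity_map (r i) (Q i) (t i) -` B))"
  obtains K where "1 \<le> K" "AE x in \<mu>. norm x \<le> K"
    "\<And>i x. i \<in> {1..N} \<Longrightarrow> x \<in> cball 0 K \<Longrightarrow> similarity_map (r i) (Q i) (t i) x \<in> cball 0 K"
proof -
  interpret prob_space \<mu> by fact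
  have space: "space \<mu> = UNIV" using sets_eq_imp_space_eq[OF sets] by simp
  define \<tau> where "\<tau> = (\<Sum>i=1..N. norm (t i))"
  have \<tau>: "norm (t i) \<le> \<tau>" if "i \<in> {1..N}" for i
    unfolding \<tau>_def using that by (intro member_le_sum) auto
  have "0 \<le> \<tau>" unfolding \<tau>_def by (intro sum_nonneg) auto
  \<comment> \<open>The fixed point of \<open>R \<mapsto> b * R + \<tau>\<close>; balls about 0 of
    radius at least \<open>K0\<close> are invariant.\<close>
  define K0 where "K0 = \<tau> / (1 - b)"
  have K0: "0 \<le> K0" "\<tau> + b * K0 = K0"
    using b \<open>0 \<le> \<tau>\<close> by (auto simp: K0_def field_simps)
  have norm_g: "norm (similarity_map (r i) (Q i) (t i) x) \<le> b * norm x + \<tau>" if i: "i \<in> {1..N}" for i x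
  proof -
    have "similitude (r i) (r i *\<^sub>R Q i)"
      using Q[OF i] r[OF i] by (intro similitude_orthogonal) auto
    then have "norm (r i *\<^sub>R (Q i *v x)) = r i * norm x"
      by (simp add: similitude_def scaleR_matrix_vector_assoc)
    also have "\<dots> \<le> b * norm x"
      using r[OF i] by (intro mult_right_mono) auto
    finally show ?thesis
      unfolding similarity_map_def using norm_triangle_ineq[of "r i *\<^sub>R (Q i *v x)" "t i"] \<tau>[OF i] by linarith
  qed
  define \<phi> where "\<phi> R = measure \<mu> {x. R < norm x}" for R
  have \<phi>_step: "\<phi> (K0 + d) \<le> \<phi> (K0 + d / b)" for d
  proof -
    have "\<phi> (K0 + d) = (\<Sum>i=1..N. p i * measure \<mu> (similarity_map (r i) (Q i) (t i) -` {x. K0 + d < norm x}))"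
      unfolding \<phi>_def by (rule st) measurable
    also have "\<dots> \<le> (\<Sum>i=1..N. p i * \<phi> (K0 + d / b))"
    proof (intro sum_mono mult_left_mono)
      fix i assume i: "i \<in> {1..N}"
      have "similarity_map (r i) (Q i) (t i) -` {x. K0 + d < norm x} \<subseteq> {x. K0 + d / b < norm x}"
      proof
        fix x assume "x \<in> similarity_map (r i) (Q i) (t i) -` {x. K0 + d < norm x}"
        then have "K0 + d < b * norm x + \<tau>"
          using norm_g[OF i, of x] by simp
        then have "b * (K0 + d / b) < b * norm x"
          using K0 b by (simp add: distrib_left)
        then show "x \<in> {x. K0 + d / b < norm x}" using b by simp
      qed
      then show "measure \<mu> (similarity_map (r i) (Q i) (t i) -` {x. K0 + d < norm x}) \<le> \<phi> (K0 + d / b)"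
        unfolding \<phi>_def by (intro finite_measure_mono) (auto simp: sets)
    qed (use p in \<open>auto intro: less_imp_le\<close>)
    also have "\<dots> = \<phi> (K0 + d / b)"
      using p(2) by (simp flip: sum_distrib_right)
    finally show ?thesis .
  qed
  have \<phi>_pow: "\<phi> (K0 + 1) \<le> \<phi> (K0 + 1 / b ^ n)" for n
  proof (induction n)
    case (Suc n)
    then show ?case using \<phi>_step[of "1 / b ^ n"] by (simp add: mult.commute)
  qed simp
  have "\<phi> (K0 + 1) \<le> \<phi> (real m)" for m
  proof -
    obtain n where n: "real m < (1 / b) ^ n"
      using real_arch_pow[of "1 / b"] b by auto
    then have "\<phi> (K0 + 1 / b ^ n) \<le> \<phi> (real m)"
      unfolding \<phi>_def using K0 by (intro finite_measure_mono) (auto simp: sets power_one_over)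
    then show ?thesis using \<phi>_pow[of n] by linarith
  qed
  moreover have "(\<lambda>m. \<phi> (real m)) \<longlonglongrightarrow> measure \<mu> (\<Inter>m. {x. real m < norm x})"
    unfolding \<phi>_def by (intro finite_Lim_measure_decseq) (auto simp: sets decseq_def)
  moreover have "(\<Inter>m. {x::real^'k. real m < norm x}) = {}"
  proof (rule equals0I)
    fix x :: "real ^ 'k"
    assume x: "x \<in> (\<Inter>m. {x. real m < norm x})"
    obtain m where "norm x < real m" using reals_Archimedean2 by blast
    with x show False by (auto dest: spec[of _ m])
  qed
  ultimately have "\<phi> (K0 + 1) \<le> 0"
    by (metis LIMSEQ_le_const measure_empty)
  then have "emeasure \<mu> {x. K0 + 1 < norm x} = 0"
    by (simp add: \<phi>_def emeasure_eq_measure measure_le_0_iff)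
  then have "AE x in \<mu>. norm x \<le> K0 + 1"
    by (intro AE_I[where N="{x. K0 + 1 < norm x}"]) (auto simp: sets)
  moreover have "similarity_map (r i) (Q i) (t i) x \<in> cball 0 (K0 + 1)"
    if "i \<in> {1..N}" "x \<in> cball 0 (K0 + 1)" for i x
  proof -
    have "b * norm x \<le> b * (K0 + 1)"
      using that b by (intro mult_left_mono) auto
    then show ?thesis
      using norm_g[OF that(1), of x] K0 b by (simp add: distrib_left)
  qed
  ultimately show ?thesis
    using K0 by (intro that[of "K0 + 1"]) auto
qed

lemma self_similar_measure_stationary_family:
  fixes \<mu> :: "(real ^ 'k) measure"
  assumes "self_similar_measure \<mu>"
  obtains K a where "1 \<le> K" "0 < a" "a \<le> 1" "AE x in \<mu>. norm x \<le> K"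
    "\<And>\<rho>. 0 < \<rho> \<Longrightarrow> \<rho> \<le> 1 \<Longrightarrow> \<exists>D. stationary_family \<mu> K (a * \<rho>) \<rho> D"
proof -
  from assms have "prob_space \<mu>" and sets: "sets \<mu> = sets borel"
    by (auto simp: self_similar_measure_def)
  interpret prob_space \<mu> by fact
  have space: "space \<mu> = UNIV" using sets_eq_imp_space_eq[OF sets] by simp
  obtain N :: nat and r Q p t where N: "N > 1"
    and *: "\<forall>i\<in>{1..N}. 0 < r i \<and> r i < 1" "\<forall>i\<in>{1..N}. orthogonal_matrix (Q i)"
      "\<forall>i\<in>{1..N}. 0 < p i \<and> p i < 1"
    and p_sum: "(\<Sum>i=1..N. p i) = 1"
    and st': "\<forall>B\<in>sets borel. measure \<mu> B =
             (\<Sum>i=1..N. p i * measure \<mu> (similarity_map (r i) (Q i) (t i) -` B))"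
    using assms unfolding self_similar_measure_def by (elim conjE exE) (rule that)
  note st = st'[rule_format]
  have r: "\<And>i. i \<in> {1..N} \<Longrightarrow> 0 < r i" "\<And>i. i \<in> {1..N} \<Longrightarrow> r i < 1"
    and Q: "\<And>i. i \<in> {1..N} \<Longrightarrow> orthogonal_matrix (Q i)"
    and p: "\<And>i. i \<in> {1..N} \<Longrightarrow> 0 < p i" "(\<Sum>i=1..N. p i) = 1"
    using * p_sum by blast+
  define b where "b = Max (r ` {1..N})"
  \<comment> \<open>Half of the least ratio, since the stopping construction needs
    \<open>a < r i\<close> strictly.\<close>
  define a where "a = Min (r ` {1..N}) / 2"
  have b: "b < 1" "\<And>i. i \<in> {1..N} \<Longrightarrow> r i \<le> b"
    using N r by (auto simp: b_def)
  have Min: "0 < Min (r ` {1..N})" "\<And>i. i \<in> {1..N} \<Longrightarrow> Min (r ` {1..N}) \<le> r i"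
    using N r by auto
  have a: "0 < a" "a < r i" if "i \<in> {1..N}" for i
    using Min(1) Min(2)[OF that] by (auto simp: a_def)
  have "0 < a" using a(1)[of 1] N by simp
  have "0 < b" "a < 1" using a(2)[of 1] b(2)[of 1] r[of 1] N by auto
  obtain K where K: "1 \<le> K" "AE x in \<mu>. norm x \<le> K"
    "\<And>i x. i \<in> {1..N} \<Longrightarrow> x \<in> cball 0 K \<Longrightarrow> similarity_map (r i) (Q i) (t i) x \<in> cball 0 K"
    using self_similar_measure_support[OF \<open>prob_space \<mu>\<close> sets _ \<open>0 < b\<close> b(1) Q p st] r(1) b(2) by blast
  define p' where "p' i = (if i \<in> {1..N} then p i else 0)" for i
  define I where "I = embed_pmf p'"
  have p': "sum p' {1..N} = 1" "0 \<le> p' i" for i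
    unfolding p(2)[symmetric] using p(1) by (auto simp: p'_def less_imp_le intro: sum.cong)
  have "(\<integral>\<^sup>+i. ennreal (p' i) \<partial>count_space UNIV) = (\<Sum>i\<in>{1..N}. ennreal (p' i))"
    by (intro nn_integral_count_space') (auto simp: p'_def)
  also have "\<dots> = 1"
    using p' by (subst sum_ennreal) auto
  finally have "pmf I i = p' i" for i
    unfolding I_def using p' by (intro pmf_embed_pmf)
  then have pmfI: "pmf I = p'" by auto
  have setI: "set_pmf I = {1..N}"
    unfolding set_pmf_eq pmfI using p(1) by (force simp: p'_def)
  have g: "similarity_map (r i) (Q i) (t i) = (\<lambda>x. (r i *\<^sub>R Q i) *v x + t i)" for i
    by (auto simp: similarity_map_def scaleR_matrix_vector_assoc)
  have meas: "similarity_map (r i) (Q i) (t i) \<in> measurable \<mu> \<mu>" for i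
    unfolding g using borel_measurable_affine[of "r i *\<^sub>R Q i" "t i"]
    by (simp add: measurable_cong_sets[OF sets sets])
  have stI: "(LINT x|\<mu>. f x) = (LINT i|measure_pmf I. LINT x|\<mu>. f ((r i *\<^sub>R Q i) *v x + t i))"
    if f: "f \<in> borel_measurable borel" "\<exists>C. \<forall>x\<in>cball 0 K. cmod (f x) \<le> C" for f :: "real ^ 'k \<Rightarrow> complex"
  proof -
    obtain C where C: "\<And>x. x \<in> cball 0 K \<Longrightarrow> cmod (f x) \<le> C" using f by blast
    \<comment> \<open>\<open>integral_stationary\<close> wants a global bound, while
      \<open>f\<close> is bounded on the ball only. Cutting \<open>f\<close> off outside changes no
      integral, as almost every point and its images lie in the ball.\<close>
    define f' where "f' x = indicator (cball 0 K) x *\<^sub>R f x" for x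
    have f'm: "f' \<in> borel_measurable borel"
      unfolding f'_def by (intro borel_measurable_scaleR borel_measurable_indicator f(1)) auto
    have eq: "f' x = f x" if "norm x \<le> K" for x using that by (simp add: f'_def)
    have "cmod (f' x) \<le> max C 0" for x
      using C[of x] by (auto simp: f'_def indicator_def)
    then have "(LINT x|\<mu>. f' x) = (LINT i|measure_pmf I. LINT x|\<mu>. f' (similarity_map (r i) (Q i) (t i) x))"
      using f'm by (intro integral_stationary[OF \<open>prob_space \<mu>\<close> _ meas])
        (auto simp: setI sets space pmfI p'_def st measurable_cong_sets[OF sets refl])
    moreover have "(LINT x|\<mu>. f' x) = (LINT x|\<mu>. f x)"
      using K(2) f f'm eq by (intro integral_cong_AE) (auto simp: measurable_cong_sets[OF sets refl])
    moreover
    have "(LINT x|\<mu>. f' (similarity_map (r i) (Q i) (t i) x)) = (LINT x|\<mu>. f (similarity_map (r i) (Q i) (t i) x))"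
      if "i \<in> set_pmf I" for i
    proof (rule integral_cong_AE)
      show "AE x in \<mu>. f' (similarity_map (r i) (Q i) (t i) x) = f (similarity_map (r i) (Q i) (t i) x)"
        using K(2) by eventually_elim (use K(3) that eq setI in auto)
    qed (intro measurable_compose[OF meas], use f(1) f'm in \<open>simp add: measurable_cong_sets[OF sets refl]\<close>)+
    then have "(LINT i|measure_pmf I. LINT x|\<mu>. f' (similarity_map (r i) (Q i) (t i) x)) =
        (LINT i|measure_pmf I. LINT x|\<mu>. f (similarity_map (r i) (Q i) (t i) x))"
      by (intro integral_cong_AE) (auto simp: AE_measure_pmf_iff)
    ultimately show ?thesis
      unfolding g by simp
  qed
  have "\<exists>D. stationary_family \<mu> K (a * \<rho>) \<rho> D" if \<rho>: "0 < \<rho>" "\<rho> \<le> 1" for \<rho>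
  proof (rule stationary_family_stopping[OF _ \<open>0 < a\<close> _ \<open>0 < b\<close> b(1) _ _ stI \<rho>(1)])
    have "1 < 1 / a" using \<open>a < 1\<close> \<open>0 < a\<close> by simp
    then show "\<rho> < 1 / a" using \<rho> by linarith
    show "a < r i \<and> r i \<le> b \<and> similitude (r i) (r i *\<^sub>R Q i)" if "i \<in> set_pmf I" for i
      using that a b Q r by (auto simp: setI intro!: similitude_orthogonal less_imp_le)
    show "(r i *\<^sub>R Q i) *v x + t i \<in> cball 0 K" if "i \<in> set_pmf I" "x \<in> cball 0 K" for i x
      using K(3)[of i x] that by (simp add: setI g)
  qed (use \<open>a < 1\<close> setI in auto)
  then show ?thesis
    using K \<open>0 < a\<close> \<open>a < 1\<close> by (intro that[of K a]) auto
qed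

section \<open>Twisted Fourier transforms and their envelope\<close>

lemma cis_diff_le: "cmod (cis s - cis t) \<le> \<bar>s - t\<bar>"
proof -
  have "cis s - cis t = cis t * (cis (s - t) - 1)"
    by (simp add: right_diff_distrib cis_mult)
  then have "cmod (cis s - cis t) = cmod (cis (s - t) - 1)"
    by (simp add: norm_mult)
  also have "\<dots> \<le> \<bar>s - t\<bar>"
    using iexp_approx1[of "s - t" 0] by (simp add: cis_conv_exp)
  finally show ?thesis .
qed

text \<open>All that the two implications use of self-similarity: a support in a ball and, at every
  scale \<open>\<rho>\<close>, a stationary family with ratios comparable to
  \<open>\<rho>\<close>.\<close>

locale multiscale =
  fixes \<mu> :: "(real ^ 'k) measure" and K a :: real
  assumes prob: "prob_space \<mu>" and sets: "sets \<mu> = sets borel"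
    and K: "1 \<le> K" and a: "0 < a" "a \<le> 1" and support: "AE x in \<mu>. norm x \<le> K"
    and families: "\<And>\<rho>. 0 < \<rho> \<Longrightarrow> \<rho> \<le> 1 \<Longrightarrow> \<exists>D. stationary_family \<mu> K (a * \<rho>) \<rho> D"
begin

sublocale prob_space \<mu> by (rule prob)

text \<open>The Fourier transform of the complex measure with density \<open>f\<close> with respect
  to \<open>\<mu>\<close>.\<close>

definition twisted :: "(real ^ 'k \<Rightarrow> complex) \<Rightarrow> real ^ 'k \<Rightarrow> complex" where
  "twisted f \<xi> = (LINT x|\<mu>. cis (- 2 * pi * (\<xi> \<bullet> x)) * f x)"

text \<open>One constant bounds both size and oscillation, so \<open>lip b\<close> scales with
  \<open>b\<close> like the balls of a norm. Both are tested on the invariant ball, where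
  \<open>\<mu>\<close> lives; measurability is asked for separately, as nothing is known
  outside.\<close>

definition lip :: "real \<Rightarrow> (real ^ 'k \<Rightarrow> complex) \<Rightarrow> bool" where
  "lip b f \<longleftrightarrow> f \<in> borel_measurable borel \<and> (\<forall>x\<in>cball 0 K. cmod (f x) \<le> b) \<and>
     (\<forall>x\<in>cball 0 K. \<forall>y\<in>cball 0 K. cmod (f x - f y) \<le> b * norm (x - y))"

text \<open>A dual norm of the modulated measure. Up to constants, the class of test functions is
  stable under multiplication by characters and under composition with the maps of a family.\<close>

definition envelope :: "real ^ 'k \<Rightarrow> real" where
  "envelope \<xi> = (SUP f\<in>Collect (lip 1). cmod (twisted f \<xi>))"

section \<open>Elementary properties of twisted transforms and of the envelope\<close>

lemma fourier_transform_eq_twisted: "fourier_transform \<mu> \<xi> = twisted (\<lambda>_. 1) \<xi>"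
  unfolding fourier_transform_def twisted_def
  by (simp add: cis_conv_exp mult_ac)

lemma borel_measurable_mu: "borel_measurable \<mu> = borel_measurable borel"
  by (rule measurable_cong_sets[OF sets refl])

lemma borel_measurable_cis_inner: "(\<lambda>x. cis (c * (\<xi> \<bullet> x))) \<in> borel_measurable (borel :: (real ^ 'k) measure)"
  unfolding cis_conv_exp by (intro borel_measurable_continuous_onI continuous_intros)

lemma integrable_if_bounded:
  fixes f :: "real ^ 'k \<Rightarrow> complex"
  assumes "f \<in> borel_measurable borel" "\<forall>x\<in>cball 0 K. cmod (f x) \<le> C"
  shows "integrable \<mu> f"
proof (rule integrable_const_bound[where B=C])
  show "AE x in \<mu>. cmod (f x) \<le> C"
    using support by eventually_elim (use assms(2) in auto)
qed (use assms in \<open>simp add: borel_measurable_mu\<close>)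

lemma norm_integral_le:
  fixes f :: "real ^ 'k \<Rightarrow> complex"
  assumes "f \<in> borel_measurable borel" "\<forall>x\<in>cball 0 K. cmod (f x) \<le> C"
  shows "cmod (LINT x|\<mu>. f x) \<le> C"
proof -
  have "integrable \<mu> f" using assms by (rule integrable_if_bounded)
  have "cmod (LINT x|\<mu>. f x) \<le> (LINT x|\<mu>. cmod (f x))"
    by (rule integral_norm_bound)
  also have "\<dots> \<le> (LINT x|\<mu>. C)"
  proof (rule integral_mono_AE)
    show "AE x in \<mu>. cmod (f x) \<le> C"
      using support by eventually_elim (use assms(2) in auto)
  qed (use \<open>integrable \<mu> f\<close> in auto)
  finally show ?thesis by (simp add: prob_space)
qed

lemma lip_measurable: "lip b f \<Longrightarrow> f \<in> borel_measurable borel"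
  and lip_bounded: "lip b f \<Longrightarrow> \<forall>x\<in>cball 0 K. cmod (f x) \<le> b"
  and lip_bound: "lip b f \<Longrightarrow> x \<in> cball 0 K \<Longrightarrow> cmod (f x) \<le> b"
  and lip_diff: "lip b f \<Longrightarrow> x \<in> cball 0 K \<Longrightarrow> y \<in> cball 0 K \<Longrightarrow> cmod (f x - f y) \<le> b * norm (x - y)"
  by (auto simp: lip_def)

lemma twisted_integrand:
  assumes "f \<in> borel_measurable borel" "\<forall>x\<in>cball 0 K. cmod (f x) \<le> C"
  shows "(\<lambda>x. cis (- 2 * pi * (\<xi> \<bullet> x)) * f x) \<in> borel_measurable borel"
    and "\<forall>x\<in>cball 0 K. cmod (cis (- 2 * pi * (\<xi> \<bullet> x)) * f x) \<le> C"
    and "integrable \<mu> (\<lambda>x. cis (- 2 * pi * (\<xi> \<bullet> x)) * f x)"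
proof -
  show m: "(\<lambda>x. cis (- 2 * pi * (\<xi> \<bullet> x)) * f x) \<in> borel_measurable borel"
    by (intro borel_measurable_times borel_measurable_cis_inner assms(1))
  show b: "\<forall>x\<in>cball 0 K. cmod (cis (- 2 * pi * (\<xi> \<bullet> x)) * f x) \<le> C"
    using assms(2) by (simp add: norm_mult)
  show "integrable \<mu> (\<lambda>x. cis (- 2 * pi * (\<xi> \<bullet> x)) * f x)"
    using m b by (rule integrable_if_bounded)
qed

lemma norm_twisted_le:
  assumes "f \<in> borel_measurable borel" "\<forall>x\<in>cball 0 K. cmod (f x) \<le> C"
  shows "cmod (twisted f \<xi>) \<le> C"
  unfolding twisted_def by (intro norm_integral_le twisted_integrand[OF assms])

lemma lip_1: "lip 1 (\<lambda>_. 1)"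
  by (simp add: lip_def)

lemma bdd_above_envelope: "bdd_above ((\<lambda>f. cmod (twisted f \<xi>)) ` Collect (lip 1))"
  by (intro bdd_aboveI2[where M=1] norm_twisted_le) (auto simp: lip_def)

lemma twisted_le_envelope_1: "lip 1 f \<Longrightarrow> cmod (twisted f \<xi>) \<le> envelope \<xi>"
  unfolding envelope_def by (intro cSUP_upper bdd_above_envelope) auto

lemma envelope_nonneg: "0 \<le> envelope \<xi>"
  using twisted_le_envelope_1[OF lip_1, of \<xi>] norm_ge_zero order_trans by blast

lemma envelope_least: "(\<And>f. lip 1 f \<Longrightarrow> cmod (twisted f \<xi>) \<le> C) \<Longrightarrow> envelope \<xi> \<le> C"
  unfolding envelope_def using lip_1 by (intro cSUP_least) auto

lemma envelope_le_1: "envelope \<xi> \<le> 1"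
  by (intro envelope_least norm_twisted_le) (auto simp: lip_def)

lemma twisted_le_envelope:
  assumes "lip b f" "0 \<le> b"
  shows "cmod (twisted f \<xi>) \<le> b * envelope \<xi>"
proof (cases "b = 0")
  case True
  then show ?thesis
    using norm_twisted_le[of f 0 \<xi>] assms by (simp add: lip_def)
next
  case False
  then have "lip 1 (\<lambda>x. f x / of_real b)"
    using assms by (auto simp: lip_def norm_divide divide_simps mult.commute simp flip: diff_divide_distrib)
  then have "cmod (twisted (\<lambda>x. f x / of_real b) \<xi>) \<le> envelope \<xi>"
    by (rule twisted_le_envelope_1)
  moreover have "twisted (\<lambda>x. f x / of_real b) \<xi> = twisted f \<xi> / of_real b"
    by (simp add: twisted_def flip: integral_divide_zero)
  ultimately show ?thesis
    using assms False by (simp add: norm_divide divide_simps mult.commute)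
qed

lemma norm_cis_inner_diff:
  "cmod (cis (- 2 * pi * (\<zeta> \<bullet> x)) - cis (- 2 * pi * (\<zeta> \<bullet> y))) \<le> 2 * pi * norm \<zeta> * norm (x - y)"
proof -
  have "cmod (cis (- 2 * pi * (\<zeta> \<bullet> x)) - cis (- 2 * pi * (\<zeta> \<bullet> y))) \<le> \<bar>- 2 * pi * (\<zeta> \<bullet> (x - y))\<bar>"
    using cis_diff_le[of "- 2 * pi * (\<zeta> \<bullet> x)" "- 2 * pi * (\<zeta> \<bullet> y)"] by (simp add: inner_diff_right algebra_simps)
  also have "\<dots> = 2 * pi * \<bar>\<zeta> \<bullet> (x - y)\<bar>"
    by (simp add: abs_mult)
  also have "\<dots> \<le> 2 * pi * (norm \<zeta> * norm (x - y))"
    by (intro mult_left_mono Cauchy_Schwarz_ineq2) auto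
  finally show ?thesis by (simp add: mult.assoc)
qed

lemma norm_cis_inner_minus_1:
  assumes "x \<in> cball 0 K"
  shows "cmod (cis (- 2 * pi * (\<zeta> \<bullet> x)) - 1) \<le> 2 * pi * norm \<zeta> * K"
proof -
  have "cmod (cis (- 2 * pi * (\<zeta> \<bullet> x)) - 1) \<le> 2 * pi * norm \<zeta> * norm x"
    using norm_cis_inner_diff[of \<zeta> x 0] by simp
  also have "\<dots> \<le> 2 * pi * norm \<zeta> * K"
    using assms by (intro mult_left_mono) auto
  finally show ?thesis .
qed

lemma lip_cis_mult:
  assumes "lip b f" "0 \<le> b"
  shows "lip (b * (1 + 2 * pi * norm \<zeta>)) (\<lambda>x. cis (- 2 * pi * (\<zeta> \<bullet> x)) * f x)"
  unfolding lip_def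
proof (intro conjI ballI)
  show "(\<lambda>x. cis (- 2 * pi * (\<zeta> \<bullet> x)) * f x) \<in> borel_measurable borel"
    using assms by (intro borel_measurable_times borel_measurable_cis_inner lip_measurable)
  have "b \<le> b * (1 + 2 * pi * norm \<zeta>)"
    using assms by (simp add: mult_le_cancel_left1)
  then show "cmod (cis (- 2 * pi * (\<zeta> \<bullet> x)) * f x) \<le> b * (1 + 2 * pi * norm \<zeta>)" if "x \<in> cball 0 K" for x
    using lip_bound[OF assms(1) that] by (simp add: norm_mult)
  fix x y :: "real ^ 'k" assume xy: "x \<in> cball 0 K" "y \<in> cball 0 K"
  let ?e = "\<lambda>x. cis (- 2 * pi * (\<zeta> \<bullet> x))"
  have "?e x * f x - ?e y * f y = (?e x - ?e y) * f x + ?e y * (f x - f y)"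
    by (simp add: algebra_simps)
  then have "cmod (?e x * f x - ?e y * f y) \<le> cmod (?e x - ?e y) * cmod (f x) + cmod (f x - f y)"
    using norm_triangle_ineq[of "(?e x - ?e y) * f x" "?e y * (f x - f y)"] by (simp add: norm_mult)
  also have "\<dots> \<le> (2 * pi * norm \<zeta> * norm (x - y)) * b + b * norm (x - y)"
    using norm_cis_inner_diff lip_bound[OF assms(1)] lip_diff[OF assms(1)] xy
    by (intro add_mono mult_mono) auto
  finally show "cmod (?e x * f x - ?e y * f y) \<le> b * (1 + 2 * pi * norm \<zeta>) * norm (x - y)"
    by (simp add: algebra_simps)
qed

text \<open>For a small frequency the character is close to 1 as a test function. Its Lipschitz
  constant is \<open>2 * pi * norm \<zeta>\<close>; by \<open>1 \<le> K\<close> the constant needed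
  for the size covers it.\<close>

lemma lip_cis_minus_1: "lip (2 * pi * norm \<zeta> * K) (\<lambda>x. cis (- 2 * pi * (\<zeta> \<bullet> x)) - 1)"
  unfolding lip_def
proof (intro conjI ballI)
  show "(\<lambda>x. cis (- 2 * pi * (\<zeta> \<bullet> x)) - 1) \<in> borel_measurable borel"
    by (intro borel_measurable_diff borel_measurable_cis_inner) auto
  fix x y :: "real ^ 'k" assume "x \<in> cball 0 K"
  then show "cmod (cis (- 2 * pi * (\<zeta> \<bullet> x)) - 1) \<le> 2 * pi * norm \<zeta> * K"
    by (rule norm_cis_inner_minus_1)
  have "cmod (cis (- 2 * pi * (\<zeta> \<bullet> x)) - cis (- 2 * pi * (\<zeta> \<bullet> y))) \<le> 2 * pi * norm \<zeta> * norm (x - y)"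
    by (rule norm_cis_inner_diff)
  also have "\<dots> \<le> 2 * pi * norm \<zeta> * norm (x - y) * K"
    using mult_left_mono[OF K, of "2 * pi * norm \<zeta> * norm (x - y)"] by simp
  finally show "cmod (cis (- 2 * pi * (\<zeta> \<bullet> x)) - 1 - (cis (- 2 * pi * (\<zeta> \<bullet> y)) - 1)) \<le> 2 * pi * norm \<zeta> * K * norm (x - y)"
    by (simp add: mult_ac)
qed

lemma twisted_shift: "twisted f (\<xi> + \<zeta>) = twisted (\<lambda>x. cis (- 2 * pi * (\<zeta> \<bullet> x)) * f x) \<xi>"
  unfolding twisted_def by (simp add: inner_add_left distrib_left cis_mult flip: mult.assoc)

lemma twisted_diff:
  assumes "lip b f" "lip c h"
  shows "twisted (\<lambda>x. f x - h x) \<xi> = twisted f \<xi> - twisted h \<xi>"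
  unfolding twisted_def right_diff_distrib
  by (intro Bochner_Integration.integral_diff twisted_integrand(3)[OF lip_measurable[OF assms(1)] lip_bounded[OF assms(1)]]
      twisted_integrand(3)[OF lip_measurable[OF assms(2)] lip_bounded[OF assms(2)]])

text \<open>Moving the frequency multiplies the test function by a character, which costs a factor.
  The change is therefore relative to the envelope itself, unlike the additive bound for a single
  Fourier transform.\<close>

lemma envelope_shift: "envelope (\<xi> + \<zeta>) \<le> (1 + 2 * pi * norm \<zeta>) * envelope \<xi>"
proof (rule envelope_least)
  fix f assume "lip 1 f"
  then have "lip (1 * (1 + 2 * pi * norm \<zeta>)) (\<lambda>x. cis (- 2 * pi * (\<zeta> \<bullet> x)) * f x)"
    by (intro lip_cis_mult) auto
  then show "cmod (twisted f (\<xi> + \<zeta>)) \<le> (1 + 2 * pi * norm \<zeta>) * envelope \<xi>"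
    unfolding twisted_shift by (intro twisted_le_envelope) auto
qed

text \<open>The error is proportional to the envelope, which may be tiny; an absolute bound would be
  too weak for comparing nearly optimal frequencies.\<close>

lemma norm_twisted_1_diff: "cmod (twisted (\<lambda>_. 1) (\<xi> + \<zeta>) - twisted (\<lambda>_. 1) \<xi>) \<le> 2 * pi * norm \<zeta> * K * envelope \<xi>"
proof -
  have "lip (1 * (1 + 2 * pi * norm \<zeta>)) (\<lambda>x. cis (- 2 * pi * (\<zeta> \<bullet> x)) * 1)"
    by (intro lip_cis_mult lip_1) auto
  then have "twisted (\<lambda>_. 1) (\<xi> + \<zeta>) - twisted (\<lambda>_. 1) \<xi> = twisted (\<lambda>x. cis (- 2 * pi * (\<zeta> \<bullet> x)) - 1) \<xi>"
    unfolding twisted_shift by (subst twisted_diff[OF _ lip_1]) auto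
  also have "cmod \<dots> \<le> 2 * pi * norm \<zeta> * K * envelope \<xi>"
    using K by (intro twisted_le_envelope lip_cis_minus_1) auto
  finally show ?thesis .
qed

section \<open>Splitting twisted transforms over a stationary family\<close>

context
  fixes lo hi :: real and D :: "((real ^ 'k ^ 'k) \<times> (real ^ 'k)) pmf"
  assumes D: "stationary_family \<mu> K lo hi D" and lo: "0 \<le> lo"
begin

lemma finite_family: "finite (set_pmf D)"
  using D by (simp add: stationary_family_def)

lemma family_similitude:
  assumes "w \<in> set_pmf D"
  obtains r where "lo < r" "r \<le> hi" "similitude r (fst w)"
  using D assms unfolding stationary_family_def by blast

lemma family_maps_to: "w \<in> set_pmf D \<Longrightarrow> x \<in> cball 0 K \<Longrightarrow> fst w *v x + snd w \<in> cball 0 K"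
  using D unfolding stationary_family_def by blast

lemma family_translation: "w \<in> set_pmf D \<Longrightarrow> snd w \<in> cball 0 K"
  using family_maps_to[of w 0] K by simp

lemma family_norm_le:
  assumes "w \<in> set_pmf D"
  shows "norm (fst w *v x) \<le> hi * norm x" "norm (\<xi> v* fst w) \<le> hi * norm \<xi>" "lo * norm \<xi> \<le> norm (\<xi> v* fst w)"
proof -
  obtain r where r: "lo < r" "r \<le> hi" "similitude r (fst w)"
    using assms by (rule family_similitude)
  then show "norm (fst w *v x) \<le> hi * norm x" "norm (\<xi> v* fst w) \<le> hi * norm \<xi>" "lo * norm \<xi> \<le> norm (\<xi> v* fst w)"
    by (auto simp: similitude_def intro: mult_right_mono)
qed

lemma sum_pmf_family: "(\<Sum>w\<in>set_pmf D. pmf D w) = 1"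
  using finite_family by (intro sum_pmf_eq_1) auto

text \<open>When \<open>fst w *v x + snd w\<close> is substituted for \<open>x\<close>, the
  translation leaves the integral as a phase and the linear part acts on the frequency by its
  transpose.\<close>

lemma twisted_family:
  assumes "f \<in> borel_measurable borel" "\<forall>x\<in>cball 0 K. cmod (f x) \<le> C"
  shows "twisted f \<xi> = (\<Sum>w\<in>set_pmf D. pmf D w *\<^sub>R
    (cis (- 2 * pi * (\<xi> \<bullet> snd w)) * twisted (\<lambda>x. f (fst w *v x + snd w)) (\<xi> v* fst w)))"
proof -
  have split: "cis (- 2 * pi * (\<xi> \<bullet> (fst w *v x + snd w))) =
      cis (- 2 * pi * (\<xi> \<bullet> snd w)) * cis (- 2 * pi * ((\<xi> v* fst w) \<bullet> x))" for w x
    unfolding cis_mult by (rule arg_cong[where f=cis]) (simp add: inner_add_right dot_lmul_matrix algebra_simps)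
  have "twisted f \<xi> = (LINT w|measure_pmf D. LINT x|\<mu>.
      cis (- 2 * pi * (\<xi> \<bullet> (fst w *v x + snd w))) * f (fst w *v x + snd w))"
    unfolding twisted_def using D twisted_integrand[OF assms, where \<xi>=\<xi>]
    unfolding stationary_family_def by blast
  also have "\<dots> = (LINT w|measure_pmf D. cis (- 2 * pi * (\<xi> \<bullet> snd w)) * twisted (\<lambda>x. f (fst w *v x + snd w)) (\<xi> v* fst w))"
    unfolding twisted_def split by (simp add: mult.assoc)
  also have "\<dots> = (\<Sum>w\<in>set_pmf D. pmf D w *\<^sub>R
    (cis (- 2 * pi * (\<xi> \<bullet> snd w)) * twisted (\<lambda>x. f (fst w *v x + snd w)) (\<xi> v* fst w)))"
    by (rule integral_measure_pmf[OF finite_family])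
  finally show ?thesis .
qed

lemma borel_measurable_comp_family:
  fixes f :: "real ^ 'k \<Rightarrow> complex" and w :: "(real ^ 'k ^ 'k) \<times> (real ^ 'k)"
  shows "f \<in> borel_measurable borel \<Longrightarrow> (\<lambda>x. f (fst w *v x + snd w)) \<in> borel_measurable borel"
  by (rule measurable_compose[OF borel_measurable_affine])

lemma lip_comp_diff:
  assumes "lip b f" "0 \<le> b" and w: "w \<in> set_pmf D" and xy: "x \<in> cball 0 K" "y \<in> cball 0 K"
  shows "cmod (f (fst w *v x + snd w) - f (fst w *v y + snd w)) \<le> b * hi * norm (x - y)"
proof -
  have "cmod (f (fst w *v x + snd w) - f (fst w *v y + snd w)) \<le> b * norm ((fst w *v x + snd w) - (fst w *v y + snd w))"
    using xy by (intro lip_diff[OF assms(1)] family_maps_to w)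
  also have "(fst w *v x + snd w) - (fst w *v y + snd w) = fst w *v (x - y)"
    by (simp add: matrix_vector_mult_diff_distrib)
  also have "b * norm (fst w *v (x - y)) \<le> b * (hi * norm (x - y))"
    using assms(2) by (intro mult_left_mono family_norm_le w)
  finally show ?thesis by (simp add: mult.assoc)
qed

lemma lip_comp_translation:
  assumes "lip b f" "0 \<le> b" and w: "w \<in> set_pmf D" and x: "x \<in> cball 0 K"
  shows "cmod (f (fst w *v x + snd w) - f (snd w)) \<le> b * hi * K"
proof -
  have "0 \<le> hi"
    using family_similitude[OF w] lo by (metis order.trans less_imp_le)
  have "cmod (f (fst w *v x + snd w) - f (snd w)) \<le> b * hi * norm x"
    using lip_comp_diff[OF assms, of 0] K by simp
  also have "\<dots> \<le> b * hi * K"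
    using x \<open>0 \<le> hi\<close> assms(2) by (intro mult_left_mono) auto
  finally show ?thesis .
qed

lemma lip_comp:
  assumes "lip b f" "0 \<le> b" "hi \<le> 1" and w: "w \<in> set_pmf D"
  shows "lip b (\<lambda>x. f (fst w *v x + snd w))"
  unfolding lip_def
proof (intro conjI ballI)
  show "(\<lambda>x. f (fst w *v x + snd w)) \<in> borel_measurable borel"
    by (rule borel_measurable_comp_family[OF lip_measurable[OF assms(1)]])
  fix x y :: "real ^ 'k" assume x: "x \<in> cball 0 K"
  then show "cmod (f (fst w *v x + snd w)) \<le> b"
    by (intro lip_bound[OF assms(1)] family_maps_to w)
  assume y: "y \<in> cball 0 K"
  have "b * hi * norm (x - y) \<le> b * 1 * norm (x - y)"
    using assms by (intro mult_right_mono mult_left_mono) auto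
  then show "cmod (f (fst w *v x + snd w) - f (fst w *v y + snd w)) \<le> b * norm (x - y)"
    using lip_comp_diff[OF assms(1,2) w x y] by simp
qed

text \<open>A function composed with a strong contraction is nearly constant; the base point
  \<open>snd w\<close> is the image of the origin.\<close>

lemma lip_comp_minus_translation:
  assumes "lip b f" "0 \<le> b" "0 \<le> hi" and w: "w \<in> set_pmf D"
  shows "lip (b * hi * K) (\<lambda>x. f (fst w *v x + snd w) - f (snd w))"
  unfolding lip_def
proof (intro conjI ballI)
  show "(\<lambda>x. f (fst w *v x + snd w) - f (snd w)) \<in> borel_measurable borel"
    by (intro borel_measurable_diff borel_measurable_comp_family[OF lip_measurable[OF assms(1)]]) auto
  fix x y :: "real ^ 'k" assume x: "x \<in> cball 0 K"
  then show "cmod (f (fst w *v x + snd w) - f (snd w)) \<le> b * hi * K"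
    by (intro lip_comp_translation assms)
  assume y: "y \<in> cball 0 K"
  have "b * hi * norm (x - y) * 1 \<le> b * hi * norm (x - y) * K"
    using assms K by (intro mult_left_mono) auto
  then show "cmod (f (fst w *v x + snd w) - f (snd w) - (f (fst w *v y + snd w) - f (snd w))) \<le> b * hi * K * norm (x - y)"
    using lip_comp_diff[OF assms(1,2) w x y] by (simp add: mult_ac)
qed

lemma envelope_le_mean:
  assumes "hi \<le> 1"
  shows "envelope \<xi> \<le> (\<Sum>w\<in>set_pmf D. pmf D w * envelope (\<xi> v* fst w))"
proof (rule envelope_least)
  fix f assume f: "lip 1 f"
  have "cmod (twisted f \<xi>) \<le> (\<Sum>w\<in>set_pmf D. cmod (pmf D w *\<^sub>R
    (cis (- 2 * pi * (\<xi> \<bullet> snd w)) * twisted (\<lambda>x. f (fst w *v x + snd w)) (\<xi> v* fst w))))"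
    unfolding twisted_family[OF lip_measurable[OF f] lip_bounded[OF f], of \<xi>] by (rule norm_sum)
  also have "\<dots> \<le> (\<Sum>w\<in>set_pmf D. pmf D w * envelope (\<xi> v* fst w))"
    using twisted_le_envelope_1[OF lip_comp[OF f _ assms]]
    by (intro sum_mono) (simp add: norm_mult mult_left_mono)
  finally show "cmod (twisted f \<xi>) \<le> (\<Sum>w\<in>set_pmf D. pmf D w * envelope (\<xi> v* fst w))" .
qed

end

end

section \<open>Nearly optimal frequencies\<close>

lemma cmod_mult_diff_le:
  "cmod (u * v - x * y) \<le> cmod (u - x) * cmod v + cmod x * cmod (v - y)"
proof -
  have "u * v - x * y = (u - x) * v + x * (v - y)"
    by (simp add: algebra_simps)
  then show ?thesis
    using norm_triangle_ineq[of "(u - x) * v" "x * (v - y)"] by (simp add: norm_mult)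
qed

text \<open>The unknown amplitude \<open>m\<close> common to both hypotheses drops out of the conclusion.\<close>
lemma phase_comparison:
  fixes e e' f f' m m' z z' :: complex
  assumes \<tau>: "0 < \<tau>" "\<tau> \<le> 1 / 100" and Q: "0 < Q" "0 < Q'" "Q' \<le> (1 + \<tau>) * Q" "Q \<le> (1 + \<tau>) * Q'"
    and e: "cmod e = 1" "cmod e' = 1" and f: "cmod f \<le> 1" "cmod f' \<le> 1"
    and z: "cmod z \<le> Q" "(1 - \<tau>) * Q \<le> cmod z" and z': "cmod z' \<le> Q'" "(1 - \<tau>) * Q' \<le> cmod z'"
    and m: "cmod m \<le> (1 + \<tau>) * Q" "cmod (m' - m) \<le> \<tau> * Q"
    and u: "cmod (e * f * m - z) \<le> 2 * \<tau> * Q" and v: "cmod (e' * f' * m' - z') \<le> 2 * \<tau> * Q'"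
  shows "cmod (e * cnj e' * (f * cnj f') - z * cnj z' / of_real (Q\<^sup>2)) \<le> 17 * \<tau>"
    and "1 - 3 * \<tau> \<le> cmod (z * cnj z' / of_real (Q\<^sup>2))"
proof -
  define h where "h = e * cnj e' * (f * cnj f')"
  define y where "y = z * cnj z'"
  define A where "A = (cmod m)\<^sup>2"
  have h: "cmod h \<le> 1"
    unfolding h_def using e f by (simp add: norm_mult mult_le_one)
  \<comment> \<open>Lets quadratic error terms be absorbed into linear ones.\<close>
  have \<tau>2: "\<tau> * \<tau> \<le> \<tau> / 100"
    using mult_left_mono[OF \<tau>(2), of \<tau>] \<tau>(1) by simp
  have "e' * f' * m - z' = (e' * f' * m' - z') - e' * f' * (m' - m)"
    by (simp add: algebra_simps)
  then have "cmod (e' * f' * m - z') \<le> cmod (e' * f' * m' - z') + cmod (e' * f' * (m' - m))"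
    by (metis norm_triangle_ineq4)
  also have "cmod (e' * f' * (m' - m)) \<le> 1 * cmod (m' - m)"
    using e f by (simp add: norm_mult mult_left_le_one_le)
  finally have "cmod (e' * f' * m - z') \<le> 2 * \<tau> * Q' + \<tau> * Q"
    using v m(2) by simp
  also have "2 * \<tau> * Q' \<le> 2 * \<tau> * ((1 + \<tau>) * Q)"
    using Q \<tau> by (intro mult_left_mono) auto
  also have "2 * \<tau> * ((1 + \<tau>) * Q) + \<tau> * Q \<le> 4 * \<tau> * Q"
    using mult_right_mono[OF \<tau>2, of Q] \<tau> Q by (simp add: algebra_simps)
  finally have v': "cmod (e' * f' * m - z') \<le> 4 * \<tau> * Q" by simp
  have "of_real A = m * cnj m"
    unfolding A_def by (rule complex_norm_square)
  \<comment> \<open>Multiplying one relation by the conjugate of the other leaves \<open>m\<close>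
    only through \<open>A\<close>, its squared modulus.\<close>
  then have "of_real A * h - y = (e * f * m) * cnj (e' * f' * m) - z * cnj z'"
    by (simp add: h_def y_def algebra_simps)
  also have "cmod \<dots> \<le> cmod (e * f * m - z) * cmod (cnj (e' * f' * m)) + cmod z * cmod (cnj (e' * f' * m) - cnj z')"
    by (rule cmod_mult_diff_le)
  also have "cmod (cnj (e' * f' * m)) = cmod f' * cmod m"
    using e by (simp add: norm_mult)
  also have "cmod (cnj (e' * f' * m) - cnj z') = cmod (e' * f' * m - z')"
    by (metis complex_cnj_diff complex_mod_cnj)
  also have "cmod (e * f * m - z) * (cmod f' * cmod m) + cmod z * cmod (e' * f' * m - z')
      \<le> (2 * \<tau> * Q) * (1 * ((1 + \<tau>) * Q)) + Q * (4 * \<tau> * Q)"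
    using u f m z v' \<tau> Q by (intro add_mono mult_mono) auto
  also have "\<dots> \<le> 7 * \<tau> * Q\<^sup>2"
    using mult_right_mono[OF \<tau>2, of "Q\<^sup>2"] \<tau> Q by (simp add: algebra_simps power2_eq_square)
  finally have Ahy: "cmod (of_real A * h - y) \<le> 7 * \<tau> * Q\<^sup>2" .
  have "(1 - 3 * \<tau>) * Q \<le> (1 - \<tau>) * ((1 - \<tau>) * Q')"
  proof -
    have "(1 - 3 * \<tau>) * Q \<le> (1 - 3 * \<tau>) * ((1 + \<tau>) * Q')"
      using Q \<tau> by (intro mult_left_mono) auto
    also have "\<dots> \<le> (1 - \<tau>) * ((1 - \<tau>) * Q')"
      using \<tau> Q by (simp add: algebra_simps power2_eq_square)
    finally show ?thesis .
  qed
  also have "\<dots> \<le> (1 - \<tau>) * cmod z'"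
    using z' \<tau> by (intro mult_left_mono) auto
  finally have "Q * ((1 - 3 * \<tau>) * Q) \<le> Q * ((1 - \<tau>) * cmod z')"
    using Q by (intro mult_left_mono) auto
  also have "\<dots> = ((1 - \<tau>) * Q) * cmod z'" by simp
  also have "\<dots> \<le> cmod z * cmod z'"
    using z by (intro mult_right_mono) auto
  finally have y: "(1 - 3 * \<tau>) * Q\<^sup>2 \<le> cmod y"
    by (simp add: y_def norm_mult power2_eq_square algebra_simps)
  then show "1 - 3 * \<tau> \<le> cmod (z * cnj z' / of_real (Q\<^sup>2))"
    using Q by (simp add: y_def[symmetric] norm_divide norm_power pos_le_divide_eq)
  have "cmod y \<le> cmod (of_real A * h) + cmod (of_real A * h - y)"
    by (metis norm_triangle_sub add.commute norm_minus_commute)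
  moreover have "cmod (of_real A * h) \<le> A"
    unfolding norm_mult norm_of_real using h by (simp add: A_def mult_left_le)
  \<comment> \<open>\<open>A\<close> is pinned near \<open>Q\<^sup>2\<close>: from below since
    \<open>y\<close> is large and \<open>h\<close> has modulus at most 1, from above by the bound on
    \<open>m\<close>. So \<open>Q\<^sup>2\<close> can replace \<open>A\<close>.\<close>
  ultimately have "(1 - 10 * \<tau>) * Q\<^sup>2 \<le> A"
    using y Ahy by (simp add: algebra_simps)
  moreover have "A \<le> (1 + 10 * \<tau>) * Q\<^sup>2"
  proof -
    have "A \<le> ((1 + \<tau>) * Q)\<^sup>2"
      unfolding A_def using m by (intro power_mono) auto
    also have "\<dots> = (1 + 2 * \<tau> + \<tau> * \<tau>) * Q\<^sup>2"
      by (simp add: power2_eq_square algebra_simps)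
    also have "\<dots> \<le> (1 + 10 * \<tau>) * Q\<^sup>2"
      using \<tau>2 \<tau> by (intro mult_right_mono) auto
    finally show ?thesis .
  qed
  ultimately have "\<bar>Q\<^sup>2 - A\<bar> \<le> 10 * \<tau> * Q\<^sup>2"
    by (simp add: algebra_simps abs_le_iff)
  moreover have "of_real (Q\<^sup>2) * h - y = of_real (Q\<^sup>2 - A) * h + (of_real A * h - y)"
    by (simp add: algebra_simps)
  then have "cmod (of_real (Q\<^sup>2) * h - y) \<le> cmod (of_real (Q\<^sup>2 - A) * h) + cmod (of_real A * h - y)"
    by (metis norm_triangle_ineq)
  moreover have "cmod (of_real (Q\<^sup>2 - A) * h) \<le> \<bar>Q\<^sup>2 - A\<bar>"
    unfolding norm_mult norm_of_real using h by (intro mult_left_le) auto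
  ultimately have main: "cmod (of_real (Q\<^sup>2) * h - y) \<le> 17 * \<tau> * Q\<^sup>2"
    using Ahy by linarith
  have "h - y / of_real (Q\<^sup>2) = (of_real (Q\<^sup>2) * h - y) / of_real (Q\<^sup>2)"
    using Q by (simp add: field_simps)
  then have "cmod (h - y / of_real (Q\<^sup>2)) = cmod (of_real (Q\<^sup>2) * h - y) / Q\<^sup>2"
    by (simp add: norm_divide norm_power)
  then show "cmod (e * cnj e' * (f * cnj f') - z * cnj z' / of_real (Q\<^sup>2)) \<le> 17 * \<tau>"
    using main Q by (simp add: h_def y_def pos_divide_le_eq)
qed

context multiscale
begin

section \<open>Root mean squares over a family and coherence\<close>

definition rms :: "((real ^ 'k ^ 'k) \<times> (real ^ 'k)) pmf \<Rightarrow> real ^ 'k \<Rightarrow> real" where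
  "rms D \<xi> = sqrt (\<Sum>w\<in>set_pmf D. pmf D w * (envelope (\<xi> v* fst w))\<^sup>2)"

lemma rms_sq: "(rms D \<xi>)\<^sup>2 = (\<Sum>w\<in>set_pmf D. pmf D w * (envelope (\<xi> v* fst w))\<^sup>2)"
  unfolding rms_def by (intro real_sqrt_pow2 sum_nonneg) auto

lemma rms_nonneg: "0 \<le> rms D \<xi>"
  unfolding rms_def by (intro real_sqrt_ge_zero sum_nonneg) auto

lemma rms_shift_le:
  assumes "\<And>w. w \<in> set_pmf D \<Longrightarrow> norm (\<zeta> v* fst w) \<le> \<kappa>"
  shows "rms D (\<xi> + \<zeta>) \<le> (1 + 2 * pi * \<kappa>) * rms D \<xi>"
proof (rule power2_le_imp_le)
  obtain w where "w \<in> set_pmf D" using set_pmf_not_empty[of D] by blast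
  then have \<kappa>: "0 \<le> \<kappa>" using assms[of w] norm_ge_zero order_trans by blast
  then show "0 \<le> (1 + 2 * pi * \<kappa>) * rms D \<xi>"
    using rms_nonneg by auto
  have "(envelope ((\<xi> + \<zeta>) v* fst w))\<^sup>2 \<le> (1 + 2 * pi * \<kappa>)\<^sup>2 * (envelope (\<xi> v* fst w))\<^sup>2"
    if w: "w \<in> set_pmf D" for w
  proof -
    have "envelope ((\<xi> + \<zeta>) v* fst w) \<le> (1 + 2 * pi * norm (\<zeta> v* fst w)) * envelope (\<xi> v* fst w)"
      unfolding vector_matrix_left_distrib by (rule envelope_shift)
    also have "\<dots> \<le> (1 + 2 * pi * \<kappa>) * envelope (\<xi> v* fst w)"
      using assms[OF w] by (intro mult_right_mono envelope_nonneg) auto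
    finally show ?thesis
      unfolding power_mult_distrib[symmetric] by (intro power_mono envelope_nonneg)
  qed
  then show "(rms D (\<xi> + \<zeta>))\<^sup>2 \<le> ((1 + 2 * pi * \<kappa>) * rms D \<xi>)\<^sup>2"
    unfolding power_mult_distrib rms_sq sum_distrib_left
    by (intro sum_mono) (simp add: mult.left_commute mult_left_mono)
qed

text \<open>Once the value at the base point is split off, the remainder is a test function with
  constant \<open>b * hi * K\<close>, so the error is again relative to the envelope.\<close>

lemma twisted_comp_approx:
  assumes D: "stationary_family \<mu> K lo hi D" and lo: "0 \<le> lo" and hi: "0 \<le> hi" "hi \<le> 1"
    and f: "lip b f" "0 \<le> b" and w: "w \<in> set_pmf D"
  shows "cmod (twisted (\<lambda>x. f (fst w *v x + snd w)) \<eta> - f (snd w) * twisted (\<lambda>_. 1) \<eta>) \<le> b * hi * K * envelope \<eta>"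
proof -
  have "lip b (\<lambda>x. f (fst w *v x + snd w))"
    by (rule lip_comp[OF D lo f hi(2) w])
  moreover have "lip b (\<lambda>_. f (snd w))"
    using lip_bound[OF f(1) family_translation[OF D lo w]] f(2) by (simp add: lip_def)
  ultimately have "twisted (\<lambda>x. f (fst w *v x + snd w) - f (snd w)) \<eta> =
      twisted (\<lambda>x. f (fst w *v x + snd w)) \<eta> - twisted (\<lambda>_. f (snd w)) \<eta>"
    by (rule twisted_diff)
  moreover have "twisted (\<lambda>_. f (snd w)) \<eta> = f (snd w) * twisted (\<lambda>_. 1) \<eta>"
    by (simp add: twisted_def mult.commute)
  moreover have "cmod (twisted (\<lambda>x. f (fst w *v x + snd w) - f (snd w)) \<eta>) \<le> b * hi * K * envelope \<eta>"
    using hi K f by (intro twisted_le_envelope lip_comp_minus_translation[OF D lo f hi(1) w]) auto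
  ultimately show ?thesis by simp
qed

text \<open>If the envelope at \<open>\<xi>\<close> almost attains its bound by the root mean square over the family,
  then the variance of the summands is small, so all of them are nearly equal.\<close>
lemma near_optimal_coherent:
  assumes D: "stationary_family \<mu> K lo hi D" and lo: "0 \<le> lo" and hi: "0 \<le> hi" "hi \<le> 1"
    and p0: "0 < p0" "\<And>w. w \<in> set_pmf D \<Longrightarrow> p0 \<le> pmf D w"
    and \<tau>: "0 < \<tau>" "\<tau> \<le> 1" and opt: "(1 - \<tau>\<^sup>2 * p0) * (rms D \<xi>)\<^sup>2 < (envelope \<xi>)\<^sup>2"
  obtains f z where "lip 1 f" "0 < rms D \<xi>" "cmod z \<le> rms D \<xi>" "(1 - \<tau>) * rms D \<xi> \<le> cmod z"
    "\<forall>w\<in>set_pmf D. envelope (\<xi> v* fst w) \<le> (1 + \<tau>) * rms D \<xi>"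
    "\<forall>w\<in>set_pmf D. cmod (cis (- 2 * pi * (\<xi> \<bullet> snd w)) * f (snd w) * twisted (\<lambda>_. 1) (\<xi> v* fst w) - z)
        \<le> (\<tau> + hi * K * (1 + \<tau>)) * rms D \<xi>"
proof -
  let ?p = "pmf D" and ?W = "set_pmf D"
  define Q where "Q = rms D \<xi>"
  note fin = finite_family[OF D lo]
  note sum1 = sum_pmf_family[OF D lo]
  have "p0 \<le> 1"
    using p0(2) pmf_le_1 set_pmf_not_empty[of D] by (meson ex_in_conv order_trans)
  then have "\<tau>\<^sup>2 * p0 \<le> \<tau>\<^sup>2"
    by (simp add: mult_left_le)
  also have "\<tau>\<^sup>2 \<le> \<tau>"
    using mult_left_mono[OF \<tau>(2), of \<tau>] \<tau>(1) by (simp add: power2_eq_square)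
  finally have c: "0 \<le> 1 - \<tau>\<^sup>2 * p0" "\<tau>\<^sup>2 * p0 \<le> \<tau>"
    using \<tau> by auto
  have Q0: "0 \<le> Q" by (simp add: Q_def rms_nonneg)
  \<comment> \<open>In this unsquared form the strict bound on the supremum yields a single test
    function \<open>f\<close> exceeding it.\<close>
  have "sqrt (1 - \<tau>\<^sup>2 * p0) * Q < envelope \<xi>"
  proof (rule power2_less_imp_less[OF _ envelope_nonneg])
    show "(sqrt (1 - \<tau>\<^sup>2 * p0) * Q)\<^sup>2 < (envelope \<xi>)\<^sup>2"
      using opt c by (simp add: Q_def power_mult_distrib)
  qed
  then obtain f where f: "lip 1 f" and f_opt: "sqrt (1 - \<tau>\<^sup>2 * p0) * Q < cmod (twisted f \<xi>)"
    using envelope_least[of \<xi> "sqrt (1 - \<tau>\<^sup>2 * p0) * Q"] by (meson not_le)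
  define z where "z = twisted f \<xi>"
  define zw where "zw w = cis (- 2 * pi * (\<xi> \<bullet> snd w)) * twisted (\<lambda>x. f (fst w *v x + snd w)) (\<xi> v* fst w)" for w
  have z: "z = (\<Sum>w\<in>?W. ?p w *\<^sub>R zw w)"
    unfolding z_def zw_def by (rule twisted_family[OF D lo lip_measurable[OF f] lip_bounded[OF f]])
  have zw_le: "cmod (zw w) \<le> envelope (\<xi> v* fst w)" if "w \<in> ?W" for w
    using twisted_le_envelope_1[OF lip_comp[OF D lo f _ hi(2) that]] by (simp add: zw_def norm_mult)
  have z_sq: "(1 - \<tau>\<^sup>2 * p0) * Q\<^sup>2 \<le> (cmod z)\<^sup>2"
    using power_mono[OF less_imp_le[OF f_opt], of 2] c Q0 by (simp add: z_def power_mult_distrib)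
  have m: "complex_of_real (\<Sum>w\<in>?W. ?p w * envelope (\<xi> v* fst w)) = (\<Sum>w\<in>?W. ?p w *\<^sub>R complex_of_real (envelope (\<xi> v* fst w)))"
    by (simp add: scaleR_conv_of_real)
  define mean where "mean = (\<Sum>w\<in>?W. ?p w * envelope (\<xi> v* fst w))"
  have "0 \<le> mean" unfolding mean_def by (intro sum_nonneg mult_nonneg_nonneg envelope_nonneg) auto
  have z_mean: "cmod z \<le> mean"
  proof -
    have "cmod z \<le> (\<Sum>w\<in>?W. cmod (?p w *\<^sub>R zw w))"
      unfolding z by (rule norm_sum)
    also have "\<dots> \<le> mean"
      unfolding mean_def using zw_le by (intro sum_mono) (simp add: mult_left_mono)
    finally show ?thesis .
  qed
  have mean_Q: "mean \<le> Q"
  proof (rule power2_le_imp_le[OF _ Q0])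
    show "mean\<^sup>2 \<le> Q\<^sup>2"
      unfolding mean_def Q_def rms_sq
      by (intro weighted_power_mean fin sum1 envelope_nonneg) auto
  qed
  \<comment> \<open>Strictness matters: for \<open>Q = 0\<close> the choice of \<open>f\<close>
    would give a nonzero \<open>z\<close>, while the modulus of \<open>z\<close> is at most
    \<open>Q\<close>.\<close>
  have "0 < Q"
  proof (rule ccontr)
    assume "\<not> 0 < Q"
    then have "Q = 0" using Q0 by simp
    then have "cmod z \<le> 0" using z_mean mean_Q by linarith
    then have "z = 0" by simp
    then show False using f_opt \<open>Q = 0\<close> by (simp add: z_def)
  qed
  have z_low: "(1 - \<tau>) * Q \<le> cmod z"
  proof (rule power2_le_imp_le)
    have "(1 - \<tau>) * (1 - \<tau>) \<le> (1 - \<tau>) * 1"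
      using \<tau> by (intro mult_left_mono) auto
    then have "(1 - \<tau>)\<^sup>2 \<le> 1 - \<tau>\<^sup>2 * p0"
      using c by (simp add: power2_eq_square)
    then have "(1 - \<tau>)\<^sup>2 * Q\<^sup>2 \<le> (1 - \<tau>\<^sup>2 * p0) * Q\<^sup>2"
      by (intro mult_right_mono) auto
    then show "((1 - \<tau>) * Q)\<^sup>2 \<le> (cmod z)\<^sup>2"
      using z_sq by (simp add: power_mult_distrib)
  qed simp
  have B: "Q\<^sup>2 - (cmod z)\<^sup>2 \<le> p0 * (\<tau> * Q)\<^sup>2"
    using z_sq by (simp add: algebra_simps power_mult_distrib)
  have near_z: "cmod (zw w - z) \<le> \<tau> * Q" if "w \<in> ?W" for w
  proof (rule near_mean_if_variance_small[OF fin sum1 p0(2) p0(1) z that _ B])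
    show "(\<Sum>w\<in>?W. ?p w * (cmod (zw w))\<^sup>2) \<le> Q\<^sup>2"
      unfolding Q_def rms_sq using zw_le by (intro sum_mono mult_left_mono power_mono) auto
  qed (use \<tau> Q0 in auto)
  \<comment> \<open>The same variance argument for the envelopes: their mean is at least the modulus
    of \<open>z\<close>, so they concentrate as well. This bounds each of them, not just their mean
    square.\<close>
  have near_mean: "cmod (complex_of_real (envelope (\<xi> v* fst w)) - of_real mean) \<le> \<tau> * Q" if "w \<in> ?W" for w
  proof (rule near_mean_if_variance_small[OF fin sum1 p0(2) p0(1) m[folded mean_def] that, where B="Q\<^sup>2"])
    show "(\<Sum>w\<in>?W. ?p w * (cmod (complex_of_real (envelope (\<xi> v* fst w))))\<^sup>2) \<le> Q\<^sup>2"
      unfolding Q_def rms_sq by simp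
    have "(cmod z)\<^sup>2 \<le> mean\<^sup>2" using z_mean by (intro power_mono) auto
    then show "Q\<^sup>2 - (cmod (of_real mean))\<^sup>2 \<le> p0 * (\<tau> * Q)\<^sup>2"
      using B by simp
  qed (use \<tau> Q0 in auto)
  have env_le: "envelope (\<xi> v* fst w) \<le> (1 + \<tau>) * Q" if "w \<in> ?W" for w
  proof -
    have "\<bar>envelope (\<xi> v* fst w) - mean\<bar> \<le> \<tau> * Q"
      using near_mean[OF that] by (simp flip: of_real_diff)
    then show ?thesis using mean_Q by (simp add: algebra_simps abs_le_iff)
  qed
  have "cmod (cis (- 2 * pi * (\<xi> \<bullet> snd w)) * f (snd w) * twisted (\<lambda>_. 1) (\<xi> v* fst w) - z)
        \<le> (\<tau> + hi * K * (1 + \<tau>)) * Q" if w: "w \<in> ?W" for w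
  proof -
    let ?e = "cis (- 2 * pi * (\<xi> \<bullet> snd w))"
    have "zw w - ?e * f (snd w) * twisted (\<lambda>_. 1) (\<xi> v* fst w) =
        ?e * (twisted (\<lambda>x. f (fst w *v x + snd w)) (\<xi> v* fst w) - f (snd w) * twisted (\<lambda>_. 1) (\<xi> v* fst w))"
      by (simp only: zw_def right_diff_distrib mult.assoc)
    then have "cmod (zw w - ?e * f (snd w) * twisted (\<lambda>_. 1) (\<xi> v* fst w)) \<le> (1 * hi * K) * envelope (\<xi> v* fst w)"
      using twisted_comp_approx[OF D lo hi f _ w] by (simp add: norm_mult)
    also have "\<dots> \<le> (1 * hi * K) * ((1 + \<tau>) * Q)"
      using hi K by (intro mult_left_mono env_le w) auto
    finally have "cmod (zw w - ?e * f (snd w) * twisted (\<lambda>_. 1) (\<xi> v* fst w)) \<le> hi * K * (1 + \<tau>) * Q"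
      by simp
    moreover have "cmod (?e * f (snd w) * twisted (\<lambda>_. 1) (\<xi> v* fst w) - z)
        \<le> cmod (zw w - ?e * f (snd w) * twisted (\<lambda>_. 1) (\<xi> v* fst w)) + cmod (zw w - z)"
      using norm_triangle_ineq4[of "zw w - z" "zw w - ?e * f (snd w) * twisted (\<lambda>_. 1) (\<xi> v* fst w)"]
      by simp
    ultimately show ?thesis
      using near_z[OF w] by (simp add: distrib_right)
  qed
  moreover have "cmod z \<le> Q" using z_mean mean_Q by simp
  ultimately show ?thesis
    using f \<open>0 < Q\<close> z_low env_le unfolding Q_def by (intro that[of f z]) auto
qed


text \<open>Modulus 1 is the equality case of the triangle inequality for integrals: the character
  is then constant almost everywhere, so \<open>\<mu>\<close> sits on countably many parallel
  hyperplanes, each of them null.\<close>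

lemma norm_twisted_1_less_1:
  assumes irr: "affinely_irreducible \<mu>" and "\<eta> \<noteq> 0"
  shows "cmod (twisted (\<lambda>_. 1) \<eta>) < 1"
proof (rule ccontr)
  define m where "m = twisted (\<lambda>_. 1) \<eta>"
  let ?e = "\<lambda>x. cis (- 2 * pi * (\<eta> \<bullet> x))"
  assume "\<not> cmod (twisted (\<lambda>_. 1) \<eta>) < 1"
  moreover have "cmod m \<le> 1"
    unfolding m_def by (rule norm_twisted_le) auto
  ultimately have m: "cmod m = 1" by (simp add: m_def)
  have int: "integrable \<mu> ?e"
    using twisted_integrand(3)[of "\<lambda>_. 1" 1 \<eta>] by simp
  define g where "g x = cnj m * ?e x" for x
  have Re_le: "Re (g x) \<le> 1" for x
    using complex_Re_le_cmod[of "g x"] m by (simp add: g_def norm_mult)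
  have intg: "integrable \<mu> g"
    unfolding g_def using int by (rule integrable_mult_right)
  have "(LINT x|\<mu>. g x) = cnj m * m"
    by (simp add: g_def m_def twisted_def)
  then have "(LINT x|\<mu>. Re (g x)) = 1"
    using intg m by (simp add: mult.commute[of "cnj m"] complex_norm_square[symmetric])
  moreover have "integrable \<mu> (\<lambda>x. Re (g x))"
    using intg by simp
  ultimately have "(LINT x|\<mu>. 1 - Re (g x)) = 0" "integrable \<mu> (\<lambda>x. 1 - Re (g x))"
    by (auto simp: prob_space)
  then have "AE x in \<mu>. 1 - Re (g x) = 0"
    using Re_le by (subst (asm) integral_nonneg_eq_0_iff_AE) auto
  then have eq: "AE x in \<mu>. \<exists>n::int. \<eta> \<bullet> x = - (Arg m / (2 * pi)) - n"
  proof eventually_elim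
    case (elim x)
    define u where "u = g x"
    have "Re u = 1" "cmod u = 1" using elim m by (auto simp: u_def g_def norm_mult)
    then have "u = 1"
      using cmod_power2[of u] by (simp add: complex_eq_iff)
    have "?e x = (m * cnj m) * ?e x"
      using m by (simp add: complex_norm_square[symmetric])
    also have "\<dots> = m * u" by (simp add: u_def g_def)
    finally have "?e x = cis (Arg m)"
      using \<open>u = 1\<close> m cis_Arg[of m] by (auto simp: sgn_eq)
    then obtain n :: int where "- 2 * pi * (\<eta> \<bullet> x) = Arg m + 2 * pi * n"
      using sin_cos_eq_iff[of "- 2 * pi * (\<eta> \<bullet> x)" "Arg m"] by (auto simp: complex_eq_iff)
    then have "\<eta> \<bullet> x = - (Arg m / (2 * pi)) - n"
      by (simp add: field_simps)
    then show ?case ..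
  qed
  have "AE x in \<mu>. \<eta> \<bullet> x \<noteq> b" for b
  proof (rule AE_I)
    show "emeasure \<mu> {x. \<eta> \<bullet> x = b} = 0"
      using irr \<open>\<eta> \<noteq> 0\<close> by (simp add: affinely_irreducible_def)
    show "{x. \<eta> \<bullet> x = b} \<in> events"
      unfolding sets by (intro borel_closed closed_hyperplane)
  qed auto
  then have "AE x in \<mu>. \<forall>n::int. \<eta> \<bullet> x \<noteq> - (Arg m / (2 * pi)) - n"
    by (subst AE_all_countable) auto
  with eq have "AE x in \<mu>. False"
    by eventually_elim auto
  then show False by simp
qed

lemma norm_twisted_1_diff_le: "cmod (twisted (\<lambda>_. 1) x - twisted (\<lambda>_. 1) y) \<le> 2 * pi * K * norm (x - y)"
proof -
  have "cmod (twisted (\<lambda>_. 1) (y + (x - y)) - twisted (\<lambda>_. 1) y) \<le> 2 * pi * norm (x - y) * K * envelope y"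
    by (rule norm_twisted_1_diff)
  also have "\<dots> \<le> 2 * pi * norm (x - y) * K * 1"
    using K by (intro mult_left_mono envelope_le_1) auto
  finally show ?thesis by (simp add: mult_ac)
qed

lemma continuous_on_twisted_1: "continuous_on S (twisted (\<lambda>_. 1))"
proof (rule continuous_on_subset)
  have "(2 * pi * K)-lipschitz_on UNIV (twisted (\<lambda>_. 1))"
  proof (rule lipschitz_onI)
    show "dist (twisted (\<lambda>_. 1) x) (twisted (\<lambda>_. 1) y) \<le> 2 * pi * K * dist x y" for x y
      unfolding dist_norm by (rule norm_twisted_1_diff_le)
  qed (use K in auto)
  then show "continuous_on UNIV (twisted (\<lambda>_. 1))"
    by (rule lipschitz_on_continuous_on)
qed simp

text \<open>Compactness makes the strict inequality uniform. A family at scale \<open>\<rho>\<close>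
  takes frequencies of norm \<open>1 / \<rho>\<close> into this annulus, whence the inner radius
  \<open>a\<close>.\<close>

lemma norm_twisted_1_annulus:
  assumes irr: "affinely_irreducible \<mu>"
  obtains c where "0 < c" "\<And>\<eta>. a \<le> norm \<eta> \<Longrightarrow> norm \<eta> \<le> 1 \<Longrightarrow> cmod (twisted (\<lambda>_. 1) \<eta>) \<le> 1 - c"
proof -
  let ?S = "cball 0 1 - ball 0 a :: (real ^ 'k) set"
  obtain x :: "real ^ 'k" where "norm x = 1"
    using vector_choose_size[of 1] by auto
  then have "x \<in> ?S" using a by auto
  then have "?S \<noteq> {}" by blast
  moreover have "compact ?S" by (intro compact_diff) auto
  moreover have "continuous_on ?S (\<lambda>\<eta>. cmod (twisted (\<lambda>_. 1) \<eta>))"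
    by (intro continuous_intros continuous_on_twisted_1)
  ultimately have "\<exists>\<eta>\<in>?S. \<forall>y\<in>?S. cmod (twisted (\<lambda>_. 1) y) \<le> cmod (twisted (\<lambda>_. 1) \<eta>)"
    by (intro continuous_attains_sup)
  then obtain \<eta> where \<eta>: "\<eta> \<in> ?S" "\<forall>y\<in>?S. cmod (twisted (\<lambda>_. 1) y) \<le> cmod (twisted (\<lambda>_. 1) \<eta>)"
    by (rule bexE)
  have "cmod (twisted (\<lambda>_. 1) \<eta>) < 1"
    using \<eta>(1) a by (intro norm_twisted_1_less_1 irr) auto
  then show ?thesis
    using \<eta>(2) by (intro that[of "1 - cmod (twisted (\<lambda>_. 1) \<eta>)"]) auto
qed

text \<open>At scale \<open>1 / norm \<zeta>\<close> every transformed frequency lies in the annulus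
  and \<open>H\<close> is nearly constant on each piece, so every summand inherits the gap found
  there.\<close>

lemma twisted_high_frequency:
  assumes irr: "affinely_irreducible \<mu>"
  obtains c K0 where "0 < c" "0 < K0"
    "\<And>\<zeta> H. K0 \<le> norm \<zeta> \<Longrightarrow> lip 2 H \<Longrightarrow> \<forall>x\<in>cball 0 K. cmod (H x) \<le> 1 \<Longrightarrow> cmod (twisted H \<zeta>) \<le> 1 - c"
proof -
  obtain c where c: "0 < c" "\<And>\<eta>. a \<le> norm \<eta> \<Longrightarrow> norm \<eta> \<le> 1 \<Longrightarrow> cmod (twisted (\<lambda>_. 1) \<eta>) \<le> 1 - c"
    using norm_twisted_1_annulus[OF irr] by blast
  \<comment> \<open>The 1 keeps the scale at most 1; \<open>4 * K / c\<close> makes the oscillation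
    error \<open>2 * \<rho> * K\<close> at most half of the gap.\<close>
  define K0 where "K0 = max 1 (4 * K / c)"
  have "cmod (twisted H \<zeta>) \<le> 1 - c / 2"
    if \<zeta>: "K0 \<le> norm \<zeta>" and H: "lip 2 H" "\<forall>x\<in>cball 0 K. cmod (H x) \<le> 1" for \<zeta> H
  proof -
    have n: "1 \<le> norm \<zeta>" "4 * K / c \<le> norm \<zeta>" using \<zeta> by (auto simp: K0_def)
    define \<rho> where "\<rho> = 1 / norm \<zeta>"
    have "0 < norm \<zeta>" using n by linarith
    then have \<rho>: "0 < \<rho>" "\<rho> \<le> 1" "\<rho> * norm \<zeta> = 1" using n by (auto simp: \<rho>_def divide_le_eq)
    have "4 * K \<le> norm \<zeta> * c" using n c(1) by (simp add: pos_divide_le_eq)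
    then have "\<rho> * (4 * K) \<le> \<rho> * (norm \<zeta> * c)"
      using \<rho> by (intro mult_left_mono) auto
    then have \<rho>K: "2 * \<rho> * K \<le> c / 2"
      using \<rho>(3) by (simp flip: mult.assoc)
    obtain D where D: "stationary_family \<mu> K (a * \<rho>) \<rho> D"
      using families[OF \<rho>(1,2)] by blast
    have lo: "0 \<le> a * \<rho>" using a \<rho> by simp
    have summand: "cmod (twisted (\<lambda>x. H (fst w *v x + snd w)) (\<zeta> v* fst w)) \<le> 1 - c / 2" if w: "w \<in> set_pmf D" for w
    proof -
      let ?\<eta> = "\<zeta> v* fst w"
      have "a * (\<rho> * norm \<zeta>) \<le> norm ?\<eta>" "norm ?\<eta> \<le> \<rho> * norm \<zeta>"
        using family_norm_le(2,3)[OF D lo w, of \<zeta>] by auto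
      then have "cmod (twisted (\<lambda>_. 1) ?\<eta>) \<le> 1 - c"
        using c(2) \<rho> by simp
      moreover have "cmod (H (snd w)) \<le> 1"
        using H(2) family_translation[OF D lo w] by blast
      ultimately have "cmod (H (snd w) * twisted (\<lambda>_. 1) ?\<eta>) \<le> 1 - c"
        unfolding norm_mult by (meson mult_left_le_one_le norm_ge_zero order_trans)
      moreover have "cmod (twisted (\<lambda>x. H (fst w *v x + snd w)) ?\<eta> - H (snd w) * twisted (\<lambda>_. 1) ?\<eta>) \<le> 2 * \<rho> * K * envelope ?\<eta>"
        using \<rho> by (intro twisted_comp_approx[OF D lo _ _ H(1) _ w]) auto
      moreover have "2 * \<rho> * K * envelope ?\<eta> \<le> 2 * \<rho> * K * 1"
        using \<rho> K by (intro mult_left_mono envelope_le_1) auto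
      ultimately show ?thesis
        using \<rho>K norm_triangle_sub[of "twisted (\<lambda>x. H (fst w *v x + snd w)) ?\<eta>" "H (snd w) * twisted (\<lambda>_. 1) ?\<eta>"]
        by linarith
    qed
    have "cmod (twisted H \<zeta>) \<le> (\<Sum>w\<in>set_pmf D. cmod (pmf D w *\<^sub>R
        (cis (- 2 * pi * (\<zeta> \<bullet> snd w)) * twisted (\<lambda>x. H (fst w *v x + snd w)) (\<zeta> v* fst w))))"
      unfolding twisted_family[OF D lo lip_measurable[OF H(1)] lip_bounded[OF H(1)], of \<zeta>] by (rule norm_sum)
    also have "\<dots> \<le> (\<Sum>w\<in>set_pmf D. pmf D w * (1 - c / 2))"
      using summand by (intro sum_mono) (simp add: norm_mult mult_left_mono)
    also have "\<dots> = 1 - c / 2"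
      using sum_pmf_family[OF D lo] by (simp flip: sum_distrib_right)
    finally show ?thesis .
  qed
  then show ?thesis
    using c(1) by (intro that[of "c / 2" K0]) (auto simp: K0_def)
qed

text \<open>Dividing the coherent phases at \<open>\<xi>\<close> by those at
  \<open>\<xi> + \<zeta>\<close> shows that the character of \<open>- \<zeta>\<close> times a fixed
  function \<open>H\<close> is nearly a constant \<open>Y\<close> at every base point. Hence
  \<open>twisted H (- \<zeta>)\<close> has modulus close to 1, which \<open>high\<close> excludes
  for large \<open>\<zeta>\<close>.\<close>

lemma near_optimal_separated:
  assumes high: "\<And>\<zeta> H. K0 \<le> norm \<zeta> \<Longrightarrow> lip 2 H \<Longrightarrow> \<forall>x\<in>cball 0 K. cmod (H x) \<le> 1 \<Longrightarrow> cmod (twisted H \<zeta>) \<le> 1 - c"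
    and \<tau>: "0 < \<tau>" "\<tau> \<le> 1 / 100" "22 * \<tau> < c" and \<kappa>: "0 < \<kappa>" "4 * pi * \<kappa> * K \<le> \<tau>"
    and \<rho>: "0 < \<rho>" "\<rho> \<le> 1" "2 * \<rho> * K \<le> \<tau>"
    and D: "stationary_family \<mu> K (a * \<rho>) \<rho> D" and p0: "0 < p0" "\<And>w. w \<in> set_pmf D \<Longrightarrow> p0 \<le> pmf D w"
    and opt: "(1 - \<tau>\<^sup>2 * p0) * (rms D \<xi>)\<^sup>2 < (envelope \<xi>)\<^sup>2"
      "(1 - \<tau>\<^sup>2 * p0) * (rms D (\<xi> + \<zeta>))\<^sup>2 < (envelope (\<xi> + \<zeta>))\<^sup>2"
    and \<zeta>: "\<rho> * norm \<zeta> \<le> \<kappa>"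
  shows "norm \<zeta> < K0"
proof -
  have lo: "0 \<le> a * \<rho>" using a \<rho> by simp
  have \<tau>1: "\<tau> \<le> 1" using \<tau> by simp
  have \<rho>0: "0 \<le> \<rho>" using \<rho> by simp
  define Q Q' where "Q = rms D \<xi>" "Q' = rms D (\<xi> + \<zeta>)"
  obtain f z where f: "lip 1 f" and Q0: "0 < Q" and z: "cmod z \<le> Q" "(1 - \<tau>) * Q \<le> cmod z"
    and env: "\<forall>w\<in>set_pmf D. envelope (\<xi> v* fst w) \<le> (1 + \<tau>) * Q"
    and u: "\<forall>w\<in>set_pmf D. cmod (cis (- 2 * pi * (\<xi> \<bullet> snd w)) * f (snd w) * twisted (\<lambda>_. 1) (\<xi> v* fst w) - z)
        \<le> (\<tau> + \<rho> * K * (1 + \<tau>)) * Q"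
    by (rule near_optimal_coherent[OF D lo \<rho>0 \<rho>(2) p0 \<tau>(1) \<tau>1 opt(1), folded Q_Q'_def]) (assumption | (rule that; assumption))+
  obtain f' z' where f': "lip 1 f'" and Q'0: "0 < Q'" and z': "cmod z' \<le> Q'" "(1 - \<tau>) * Q' \<le> cmod z'"
    and v: "\<forall>w\<in>set_pmf D. cmod (cis (- 2 * pi * ((\<xi> + \<zeta>) \<bullet> snd w)) * f' (snd w) * twisted (\<lambda>_. 1) ((\<xi> + \<zeta>) v* fst w) - z')
        \<le> (\<tau> + \<rho> * K * (1 + \<tau>)) * Q'"
    by (rule near_optimal_coherent[OF D lo \<rho>0 \<rho>(2) p0 \<tau>(1) \<tau>1 opt(2), folded Q_Q'_def]) (assumption | (rule that; assumption))+
  have "\<rho> * K * \<tau> \<le> \<rho> * K * 1"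
    using \<tau>1 \<rho> K by (intro mult_left_mono) auto
  then have coeff: "\<tau> + \<rho> * K * (1 + \<tau>) \<le> 2 * \<tau>"
    using \<rho>(3) by (simp add: algebra_simps)
  have \<zeta>w: "norm (\<zeta> v* fst w) \<le> \<kappa>" "norm ((- \<zeta>) v* fst w) \<le> \<kappa>" if "w \<in> set_pmf D" for w
    using family_norm_le(2)[OF D lo that, of \<zeta>] family_norm_le(2)[OF D lo that, of "- \<zeta>"] \<zeta> by auto
  have "4 * pi * \<kappa> * 1 \<le> 4 * pi * \<kappa> * K"
    using K \<kappa> by (intro mult_left_mono) auto
  then have \<kappa>\<tau>: "2 * pi * \<kappa> \<le> \<tau>" using \<kappa> \<tau> by linarith
  have "Q' \<le> (1 + 2 * pi * \<kappa>) * Q" "Q \<le> (1 + 2 * pi * \<kappa>) * Q'"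
    unfolding Q_Q'_def using rms_shift_le[of D \<zeta> \<kappa> \<xi>] rms_shift_le[of D "- \<zeta>" \<kappa> "\<xi> + \<zeta>"] \<zeta>w by auto
  moreover have "(1 + 2 * pi * \<kappa>) * Q \<le> (1 + \<tau>) * Q" "(1 + 2 * pi * \<kappa>) * Q' \<le> (1 + \<tau>) * Q'"
    using \<kappa>\<tau> Q0 Q'0 by (auto intro: mult_right_mono)
  ultimately have QQ': "Q' \<le> (1 + \<tau>) * Q" "Q \<le> (1 + \<tau>) * Q'" by auto
  \<comment> \<open>The ratio of the two test functions, in product form. The product rule gives the
    Lipschitz constant 2, hence \<open>lip 2\<close> in \<open>high\<close>.\<close>
  define H where "H x = f x * cnj (f' x)" for x
  have H1: "\<forall>x\<in>cball 0 K. cmod (H x) \<le> 1"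
    using lip_bound[OF f] lip_bound[OF f'] by (auto simp: H_def norm_mult intro!: mult_le_one)
  have H2: "lip 2 H"
    unfolding lip_def
  proof (intro conjI ballI)
    have "(\<lambda>x. cnj x) \<in> borel_measurable borel"
      by (intro borel_measurable_continuous_onI continuous_intros)
    then show "H \<in> borel_measurable borel"
      unfolding H_def
      by (intro borel_measurable_times lip_measurable[OF f] measurable_compose[OF lip_measurable[OF f']])
    fix x y :: "real ^ 'k" assume x: "x \<in> cball 0 K"
    then show "cmod (H x) \<le> 2" using H1 by force
    assume y: "y \<in> cball 0 K"
    have "cmod (H x - H y) \<le> cmod (f x - f y) * cmod (cnj (f' x)) + cmod (f y) * cmod (cnj (f' x) - cnj (f' y))"
      unfolding H_def by (rule cmod_mult_diff_le)
    also have "cmod (cnj (f' x) - cnj (f' y)) = cmod (f' x - f' y)"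
      by (metis complex_cnj_diff complex_mod_cnj)
    also have "cmod (f x - f y) * cmod (cnj (f' x)) + cmod (f y) * cmod (f' x - f' y) \<le> (1 * norm (x - y)) * 1 + 1 * (1 * norm (x - y))"
      using lip_bound[OF f y] lip_bound[OF f' x] lip_diff[OF f x y] lip_diff[OF f' x y] by (intro add_mono mult_mono) auto
    finally show "cmod (H x - H y) \<le> 2 * norm (x - y)" by simp
  qed
  define Y where "Y = z * cnj z' / of_real (Q\<^sup>2)"
  define E where "E w = cis (- 2 * pi * ((- \<zeta>) \<bullet> snd w)) * twisted (\<lambda>x. H (fst w *v x + snd w)) ((- \<zeta>) v* fst w)" for w
  \<comment> \<open>The error budget: \<open>17 * \<tau>\<close> for the phases,
    \<open>\<tau>\<close> for freezing \<open>H\<close> at the base point, \<open>\<tau>\<close> for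
    the nearly vanishing frequency. With the loss \<open>3 * \<tau>\<close> in \<open>Y\<close> this
    makes the \<open>22 * \<tau>\<close> of the hypothesis.\<close>
  have main: "cmod (E w - Y) \<le> 19 * \<tau>" "1 - 3 * \<tau> \<le> cmod Y" if w: "w \<in> set_pmf D" for w
  proof -
    let ?t = "snd w"
    have t: "?t \<in> cball 0 K" by (rule family_translation[OF D lo w])
    let ?m = "twisted (\<lambda>_. 1) (\<xi> v* fst w)" and ?m' = "twisted (\<lambda>_. 1) ((\<xi> + \<zeta>) v* fst w)"
    let ?e = "cis (- 2 * pi * (\<xi> \<bullet> ?t))" and ?e' = "cis (- 2 * pi * ((\<xi> + \<zeta>) \<bullet> ?t))"
    have m: "cmod ?m \<le> (1 + \<tau>) * Q"
      using twisted_le_envelope_1[OF lip_1, of "\<xi> v* fst w"] bspec[OF env w] by linarith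
    have "cmod (?m' - ?m) \<le> 2 * pi * norm (\<zeta> v* fst w) * K * envelope (\<xi> v* fst w)"
      unfolding vector_matrix_left_distrib by (rule norm_twisted_1_diff)
    also have "\<dots> \<le> 2 * pi * \<kappa> * K * ((1 + \<tau>) * Q)"
      using \<zeta>w[OF w] bspec[OF env w] K \<kappa> by (intro mult_mono envelope_nonneg) auto
    also have "\<dots> \<le> 2 * pi * \<kappa> * K * (2 * Q)"
      using \<tau>1 Q0 K \<kappa> by (intro mult_left_mono mult_right_mono) auto
    also have "\<dots> \<le> \<tau> * Q"
      using mult_right_mono[OF \<kappa>(2), of Q] Q0 by simp
    finally have m': "cmod (?m' - ?m) \<le> \<tau> * Q" .
    have u': "cmod (?e * f ?t * ?m - z) \<le> 2 * \<tau> * Q"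
      using bspec[OF u w] mult_right_mono[OF coeff, of Q] Q0 by linarith
    have v': "cmod (?e' * f' ?t * ?m' - z') \<le> 2 * \<tau> * Q'"
      using bspec[OF v w] mult_right_mono[OF coeff, of Q'] Q'0 by linarith
    note pc = phase_comparison[OF \<tau>(1,2) Q0 Q'0 QQ' _ _ lip_bound[OF f t] lip_bound[OF f' t] z z' m m' u' v']
    show "1 - 3 * \<tau> \<le> cmod Y"
      unfolding Y_def by (rule pc(2)) auto
    have "cmod (?e * cnj ?e' * H ?t - Y) \<le> 17 * \<tau>"
      unfolding Y_def H_def by (rule pc(1)) auto
    moreover have "?e * cnj ?e' = cis (- 2 * pi * ((- \<zeta>) \<bullet> ?t))"
      unfolding cis_cnj cis_mult by (rule arg_cong[where f=cis]) (simp add: inner_add_left algebra_simps)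
    ultimately have 1: "cmod (cis (- 2 * pi * ((- \<zeta>) \<bullet> ?t)) * H ?t - Y) \<le> 17 * \<tau>" by simp
    let ?\<eta> = "(- \<zeta>) v* fst w"
    have "cmod (twisted (\<lambda>x. H (fst w *v x + ?t)) ?\<eta> - H ?t * twisted (\<lambda>_. 1) ?\<eta>) \<le> 2 * \<rho> * K * envelope ?\<eta>"
      using \<rho> by (intro twisted_comp_approx[OF D lo _ _ H2 _ w]) auto
    also have "\<dots> \<le> 2 * \<rho> * K * 1"
      using \<rho> K by (intro mult_left_mono envelope_le_1) auto
    also have "\<dots> \<le> \<tau>" using \<rho> by simp
    finally have 2: "cmod (twisted (\<lambda>x. H (fst w *v x + ?t)) ?\<eta> - H ?t * twisted (\<lambda>_. 1) ?\<eta>) \<le> \<tau>" .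
    \<comment> \<open>By \<open>\<rho> * norm \<zeta> \<le> \<kappa>\<close> the transformed
      frequency is nearly 0, where the transform is nearly 1.\<close>
    have "twisted (\<lambda>_. 1) 0 = 1"
      by (simp add: twisted_def prob_space)
    then have "cmod (twisted (\<lambda>_. 1) ?\<eta> - 1) \<le> 2 * pi * norm ?\<eta> * K * envelope 0"
      using norm_twisted_1_diff[of 0 ?\<eta>] by simp
    also have "\<dots> \<le> 2 * pi * \<kappa> * K * 1"
      using \<zeta>w[OF w] K \<kappa> by (intro mult_mono envelope_le_1 envelope_nonneg) auto
    also have "\<dots> \<le> \<tau>" using \<kappa> \<tau> by simp
    finally have "cmod (twisted (\<lambda>_. 1) ?\<eta> - 1) \<le> \<tau>" .
    moreover have "cmod (H ?t) \<le> 1" using H1 t by blast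
    ultimately have "cmod (H ?t) * cmod (twisted (\<lambda>_. 1) ?\<eta> - 1) \<le> 1 * \<tau>"
      using \<tau> by (intro mult_mono) auto
    moreover have "H ?t * twisted (\<lambda>_. 1) ?\<eta> - H ?t = H ?t * (twisted (\<lambda>_. 1) ?\<eta> - 1)"
      by (simp add: algebra_simps)
    ultimately have 3: "cmod (H ?t * twisted (\<lambda>_. 1) ?\<eta> - H ?t) \<le> \<tau>"
      by (simp only: norm_mult mult_1)
    have "E w - cis (- 2 * pi * ((- \<zeta>) \<bullet> ?t)) * H ?t =
        cis (- 2 * pi * ((- \<zeta>) \<bullet> ?t)) * (twisted (\<lambda>x. H (fst w *v x + ?t)) ?\<eta> - H ?t)"
      by (simp only: E_def right_diff_distrib)
    then have "cmod (E w - cis (- 2 * pi * ((- \<zeta>) \<bullet> ?t)) * H ?t) = cmod (twisted (\<lambda>x. H (fst w *v x + ?t)) ?\<eta> - H ?t)"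
      by (simp only: norm_mult norm_cis mult_1)
    also have "\<dots> \<le> 2 * \<tau>"
      using norm_triangle_ineq[of "twisted (\<lambda>x. H (fst w *v x + ?t)) ?\<eta> - H ?t * twisted (\<lambda>_. 1) ?\<eta>" "H ?t * twisted (\<lambda>_. 1) ?\<eta> - H ?t"] 2 3
      by simp
    finally show "cmod (E w - Y) \<le> 19 * \<tau>"
      using norm_triangle_ineq[of "E w - cis (- 2 * pi * ((- \<zeta>) \<bullet> ?t)) * H ?t" "cis (- 2 * pi * ((- \<zeta>) \<bullet> ?t)) * H ?t - Y"] 1
      by simp
  qed
  have tw: "twisted H (- \<zeta>) = (\<Sum>w\<in>set_pmf D. pmf D w *\<^sub>R E w)"
    unfolding E_def by (rule twisted_family[OF D lo lip_measurable[OF H2] lip_bounded[OF H2]])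
  have "(\<Sum>w\<in>set_pmf D. pmf D w *\<^sub>R Y) = Y"
    by (simp only: scaleR_sum_left[symmetric] sum_pmf_family[OF D lo] scaleR_one)
  then have "twisted H (- \<zeta>) - Y = (\<Sum>w\<in>set_pmf D. pmf D w *\<^sub>R (E w - Y))"
    by (simp only: tw scaleR_right_diff_distrib sum_subtractf)
  then have "cmod (twisted H (- \<zeta>) - Y) \<le> (\<Sum>w\<in>set_pmf D. cmod (pmf D w *\<^sub>R (E w - Y)))"
    by (simp only: norm_sum)
  also have "\<dots> \<le> (\<Sum>w\<in>set_pmf D. pmf D w * (19 * \<tau>))"
    using main(1) by (intro sum_mono) (simp add: mult_left_mono)
  also have "\<dots> = 19 * \<tau>"
    using sum_pmf_family[OF D lo] by (simp flip: sum_distrib_right)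
  finally have "cmod (twisted H (- \<zeta>) - Y) \<le> 19 * \<tau>" .
  moreover have "1 - 3 * \<tau> \<le> cmod Y"
    using main(2) set_pmf_not_empty[of D] by blast
  ultimately have "1 - 22 * \<tau> \<le> cmod (twisted H (- \<zeta>))"
    using norm_triangle_ineq2[of Y "Y - twisted H (- \<zeta>)"] by (simp add: norm_minus_commute)
  then have "1 - c < cmod (twisted H (- \<zeta>))" using \<tau> by simp
  then show ?thesis
    using high[of "- \<zeta>" H] H2 H1 by force
qed


section \<open>Moments over separated sets\<close>

text \<open>Fixes the constants. \<open>D\<close> and the threshold \<open>d\<close> depend on
  \<open>\<rho>\<close>, whereas \<open>s\<close> and \<open>\<kappa>\<close> come from the gap at
  high frequencies and do not; this later frees the growth factor from
  \<open>\<rho>\<close>.\<close>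

lemma near_optimal_sparse:
  assumes irr: "affinely_irreducible \<mu>"
  obtains s \<kappa> \<rho>0 where "0 < s" "0 < \<kappa>" "0 < \<rho>0"
    "\<And>\<rho>. 0 < \<rho> \<Longrightarrow> \<rho> \<le> 1 \<Longrightarrow> \<rho> \<le> \<rho>0 \<Longrightarrow> \<exists>D d. stationary_family \<mu> K (a * \<rho>) \<rho> D \<and> 0 < d \<and> d \<le> 1 \<and>
       (\<forall>\<xi> \<xi>'. (1 - d) * (rms D \<xi>)\<^sup>2 < (envelope \<xi>)\<^sup>2 \<longrightarrow> (1 - d) * (rms D \<xi>')\<^sup>2 < (envelope \<xi>')\<^sup>2 \<longrightarrow>
          s \<le> dist \<xi> \<xi>' \<longrightarrow> \<kappa> \<le> \<rho> * dist \<xi> \<xi>')"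
proof -
  obtain c K0 where c: "0 < c" "0 < K0"
    and high: "\<And>\<zeta> H. K0 \<le> norm \<zeta> \<Longrightarrow> lip 2 H \<Longrightarrow> \<forall>x\<in>cball 0 K. cmod (H x) \<le> 1 \<Longrightarrow> cmod (twisted H \<zeta>) \<le> 1 - c"
    using twisted_high_frequency[OF irr] by metis
  define \<tau> where "\<tau> = min (1 / 100) (c / 23)"
  have \<tau>: "0 < \<tau>" "\<tau> \<le> 1 / 100" "22 * \<tau> < c" using c by (auto simp: \<tau>_def min_def)
  define \<kappa> where "\<kappa> = \<tau> / (4 * pi * K)"
  have \<kappa>: "0 < \<kappa>" "4 * pi * \<kappa> * K \<le> \<tau>" using \<tau> K by (auto simp: \<kappa>_def)
  have "\<exists>D d. stationary_family \<mu> K (a * \<rho>) \<rho> D \<and> 0 < d \<and> d \<le> 1 \<and>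
       (\<forall>\<xi> \<xi>'. (1 - d) * (rms D \<xi>)\<^sup>2 < (envelope \<xi>)\<^sup>2 \<longrightarrow> (1 - d) * (rms D \<xi>')\<^sup>2 < (envelope \<xi>')\<^sup>2 \<longrightarrow>
          K0 \<le> dist \<xi> \<xi>' \<longrightarrow> \<kappa> \<le> \<rho> * dist \<xi> \<xi>')"
    if \<rho>: "0 < \<rho>" "\<rho> \<le> 1" "\<rho> \<le> \<tau> / (2 * K)" for \<rho>
  proof -
    have \<rho>K: "2 * \<rho> * K \<le> \<tau>" using \<rho>(3) K by (simp add: field_simps)
    obtain D where D: "stationary_family \<mu> K (a * \<rho>) \<rho> D"
      using families[OF \<rho>(1,2)] by blast
    have lo: "0 \<le> a * \<rho>" using a \<rho> by simp
    note fin = finite_family[OF D lo]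
    \<comment> \<open>The least weight depends on \<open>\<rho>\<close>, which is harmless because
      it enters only \<open>d\<close>, chosen as \<open>\<tau>\<^sup>2 * p0\<close>.\<close>
    define p0 where "p0 = Min (pmf D ` set_pmf D)"
    have "p0 \<in> pmf D ` set_pmf D"
      unfolding p0_def using fin set_pmf_not_empty by (intro Min_in) auto
    then have p0: "0 < p0" "p0 \<le> 1"
      by (auto simp: pmf_le_1 pmf_positive)
    have p0_le: "p0 \<le> pmf D w" if "w \<in> set_pmf D" for w
      unfolding p0_def using fin that by simp
    have "\<tau>\<^sup>2 * p0 \<le> 1"
      using \<tau> p0 by (intro mult_le_one power_le_one) auto
    moreover have "\<kappa> \<le> \<rho> * dist \<xi> \<xi>'"
      if opt: "(1 - \<tau>\<^sup>2 * p0) * (rms D \<xi>)\<^sup>2 < (envelope \<xi>)\<^sup>2" "(1 - \<tau>\<^sup>2 * p0) * (rms D \<xi>')\<^sup>2 < (envelope \<xi>')\<^sup>2"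
        and far: "K0 \<le> dist \<xi> \<xi>'" for \<xi> \<xi>'
    proof (rule ccontr)
      assume "\<not> \<kappa> \<le> \<rho> * dist \<xi> \<xi>'"
      then have "\<rho> * norm (\<xi>' - \<xi>) \<le> \<kappa>"
        by (simp add: dist_norm norm_minus_commute)
      moreover have "(1 - \<tau>\<^sup>2 * p0) * (rms D (\<xi> + (\<xi>' - \<xi>)))\<^sup>2 < (envelope (\<xi> + (\<xi>' - \<xi>)))\<^sup>2"
        using opt(2) by simp
      ultimately have "norm (\<xi>' - \<xi>) < K0"
        using near_optimal_separated[OF high \<tau> \<kappa> \<rho>(1,2) \<rho>K D p0(1) p0_le opt(1)] by blast
      then show False using far by (simp add: dist_norm norm_minus_commute)
    qed
    ultimately show ?thesis
      using D p0 \<tau> by (intro exI[of _ D] exI[of _ "\<tau>\<^sup>2 * p0"]) auto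
  qed
  then show ?thesis
    using c \<kappa> \<tau> K by (intro that[of K0 \<kappa> "\<tau> / (2 * K)"]) auto
qed

text \<open>A discrete stand-in for integrating a power of the envelope over a ball. The exponent is
  even because the recursion holds for squares.\<close>

definition moment_bound :: "real \<Rightarrow> nat \<Rightarrow> real \<Rightarrow> real \<Rightarrow> bool" where
  "moment_bound s q R B \<longleftrightarrow> (\<forall>E. finite E \<longrightarrow> E \<subseteq> cball 0 R \<longrightarrow> (\<forall>x\<in>E. \<forall>y\<in>E. x \<noteq> y \<longrightarrow> s \<le> dist x y) \<longrightarrow>
     (\<Sum>\<xi>\<in>E. envelope \<xi> ^ (2 * q)) \<le> B)"

lemma moment_bound_1:
  assumes "0 < s"
  shows "moment_bound s q 1 ((1 + 2 / s) ^ CARD('k))"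
  unfolding moment_bound_def
proof (intro allI impI)
  fix E :: "(real ^ 'k) set"
  assume E: "finite E" "E \<subseteq> cball 0 1" "\<forall>x\<in>E. \<forall>y\<in>E. x \<noteq> y \<longrightarrow> s \<le> dist x y"
  have "(\<Sum>\<xi>\<in>E. envelope \<xi> ^ (2 * q)) \<le> (\<Sum>\<xi>\<in>E. 1)"
    by (intro sum_mono power_le_one envelope_nonneg envelope_le_1)
  also have "\<dots> = real (card E)" by simp
  also have "\<dots> \<le> (1 + 2 * 1 / s) ^ DIM(real ^ 'k)"
    using E assms by (intro separated_card_le[of E 0]) auto
  finally show "(\<Sum>\<xi>\<in>E. envelope \<xi> ^ (2 * q)) \<le> (1 + 2 / s) ^ CARD('k)" by simp
qed

text \<open>Each map sends \<open>F\<close> into the ball of radius \<open>R\<close> and keeps it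
  \<open>lo * \<sigma>\<close>-separated, so the bound at radius \<open>R\<close> applies through
  \<open>separated_transfer\<close>; then average over the maps.\<close>

lemma moment_transfer:
  assumes D: "stationary_family \<mu> K lo \<rho> D" and lo: "0 < lo" and \<rho>: "0 < \<rho>"
    and R: "moment_bound s q R B" and s: "0 < s" and F: "finite F" "F \<subseteq> cball 0 (R / \<rho>)" "0 < \<sigma>"
      "\<And>x y. x \<in> F \<Longrightarrow> y \<in> F \<Longrightarrow> x \<noteq> y \<Longrightarrow> \<sigma> \<le> dist x y"
  shows "(\<Sum>\<xi>\<in>F. \<Sum>w\<in>set_pmf D. pmf D w * envelope (\<xi> v* fst w) ^ (2 * q)) \<le> (1 + 2 * s / (lo * \<sigma>)) ^ CARD('k) * B"
proof -
  have lo0: "0 \<le> lo" using lo by simp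
  have inner: "(\<Sum>\<xi>\<in>F. envelope (\<xi> v* fst w) ^ (2 * q)) \<le> (1 + 2 * s / (lo * \<sigma>)) ^ CARD('k) * B"
    if w: "w \<in> set_pmf D" for w
  proof -
    define T where "T \<xi> = \<xi> v* fst w" for \<xi>
    have T: "lo * dist x y \<le> dist (T x) (T y)" for x y
      using family_norm_le(3)[OF D lo0 w, of "x - y"] by (simp add: T_def dist_norm vector_matrix_mult_diff_distrib)
    have "inj_on T F"
    proof (rule inj_onI)
      fix x y assume "T x = T y"
      then have "lo * dist x y \<le> 0" using T[of x y] by simp
      then show "x = y" using lo by (simp add: mult_le_0_iff)
    qed
    then have "(\<Sum>\<xi>\<in>F. envelope (T \<xi>) ^ (2 * q)) = (\<Sum>\<eta>\<in>T ` F. envelope \<eta> ^ (2 * q))"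
      by (simp add: sum.reindex)
    also have "\<dots> \<le> (1 + 2 * s / (lo * \<sigma>)) ^ DIM(real ^ 'k) * B"
    proof (rule separated_transfer)
      show "T ` F \<subseteq> cball 0 R"
      proof safe
        fix \<xi> assume "\<xi> \<in> F"
        then have "norm \<xi> \<le> R / \<rho>" using F by auto
        then have "\<rho> * norm \<xi> \<le> R" using \<rho> by (simp add: pos_le_divide_eq mult.commute)
        then show "T \<xi> \<in> cball 0 R"
          using family_norm_le(2)[OF D lo0 w, of \<xi>] by (simp add: T_def)
      qed
      show "lo * \<sigma> \<le> dist x y" if "x \<in> T ` F" "y \<in> T ` F" "x \<noteq> y" for x y
      proof -
        from that obtain x' y' where xy: "x' \<in> F" "y' \<in> F" "x = T x'" "y = T y'" by blast
        then have "\<sigma> \<le> dist x' y'" using that F(4) by blast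
        then have "lo * \<sigma> \<le> lo * dist x' y'" using lo by simp
        then show ?thesis using T[of x' y'] xy by simp
      qed
      show "(\<Sum>\<eta>\<in>E. envelope \<eta> ^ (2 * q)) \<le> B"
        if "finite E" "E \<subseteq> cball 0 R" "\<forall>x\<in>E. \<forall>y\<in>E. x \<noteq> y \<longrightarrow> s \<le> dist x y" for E
        using R that unfolding moment_bound_def by blast
    qed (use F s lo envelope_nonneg in auto)
    finally show ?thesis by (simp add: T_def)
  qed
  have "(\<Sum>\<xi>\<in>F. \<Sum>w\<in>set_pmf D. pmf D w * envelope (\<xi> v* fst w) ^ (2 * q)) =
      (\<Sum>w\<in>set_pmf D. pmf D w * (\<Sum>\<xi>\<in>F. envelope (\<xi> v* fst w) ^ (2 * q)))"
    by (subst sum.swap) (simp add: sum_distrib_left)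
  also have "\<dots> \<le> (\<Sum>w\<in>set_pmf D. pmf D w * ((1 + 2 * s / (lo * \<sigma>)) ^ CARD('k) * B))"
    using inner by (intro sum_mono mult_left_mono) auto
  also have "\<dots> = (1 + 2 * s / (lo * \<sigma>)) ^ CARD('k) * B"
    using sum_pmf_family[OF D lo0] by (simp only: sum_distrib_right[symmetric] mult_1)
  finally show ?thesis .
qed

lemma envelope_le_rms:
  assumes D: "stationary_family \<mu> K lo hi D" and lo: "0 \<le> lo" and hi: "hi \<le> 1"
  shows "(envelope \<xi>)\<^sup>2 \<le> (rms D \<xi>)\<^sup>2"
proof -
  have "(envelope \<xi>)\<^sup>2 \<le> (\<Sum>w\<in>set_pmf D. pmf D w * envelope (\<xi> v* fst w))\<^sup>2"
    by (intro power_mono envelope_le_mean[OF D lo hi] envelope_nonneg)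
  also have "\<dots> \<le> (rms D \<xi>)\<^sup>2"
    unfolding rms_sq
    by (intro weighted_power_mean finite_family[OF D lo] sum_pmf_family[OF D lo] envelope_nonneg) auto
  finally show ?thesis .
qed

text \<open>Jensen raises the inequality for squares to the power \<open>q\<close>. It is used with
  \<open>c = 1\<close> at nearly optimal points and with \<open>c = 1 - d\<close> elsewhere, where a
  large \<open>q\<close> gains.\<close>

lemma envelope_power_le:
  assumes D: "stationary_family \<mu> K lo hi D" and lo: "0 \<le> lo" and c: "0 \<le> c"
    and le: "(envelope \<xi>)\<^sup>2 \<le> c * (rms D \<xi>)\<^sup>2"
  shows "envelope \<xi> ^ (2 * q) \<le> c ^ q * (\<Sum>w\<in>set_pmf D. pmf D w * envelope (\<xi> v* fst w) ^ (2 * q))"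
proof -
  have "envelope \<xi> ^ (2 * q) \<le> (c * (rms D \<xi>)\<^sup>2) ^ q"
    unfolding power_mult using le by (intro power_mono) auto
  also have "\<dots> = c ^ q * ((rms D \<xi>)\<^sup>2) ^ q"
    by (rule power_mult_distrib)
  also have "\<dots> \<le> c ^ q * (\<Sum>w\<in>set_pmf D. pmf D w * envelope (\<xi> v* fst w) ^ (2 * q))"
    unfolding rms_sq power_mult using c
    by (intro mult_left_mono weighted_power_mean finite_family[OF D lo] sum_pmf_family[OF D lo]) auto
  finally show ?thesis .
qed

text \<open>Only the points where the envelope is nearly optimal contribute to the growth factor; there the
  separation \<open>\<kappa> / \<rho>\<close> makes the factor independent of \<open>\<rho>\<close>. The remaining points have
  lost a factor \<open>(1 - d) ^ q\<close>.\<close>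
lemma moment_step:
  assumes D: "stationary_family \<mu> K (a * \<rho>) \<rho> D" and \<rho>: "0 < \<rho>" "\<rho> \<le> 1" and d: "0 < d" "d \<le> 1"
    and sparse: "\<forall>\<xi> \<xi>'. (1 - d) * (rms D \<xi>)\<^sup>2 < (envelope \<xi>)\<^sup>2 \<longrightarrow> (1 - d) * (rms D \<xi>')\<^sup>2 < (envelope \<xi>')\<^sup>2 \<longrightarrow>
          s \<le> dist \<xi> \<xi>' \<longrightarrow> \<kappa> \<le> \<rho> * dist \<xi> \<xi>'"
    and s: "0 < s" and \<kappa>: "0 < \<kappa>"
    and q: "(1 - d) ^ q * (1 + 2 / (a * \<rho>)) ^ CARD('k) \<le> 1"
    and R: "moment_bound s q R B" and B: "0 \<le> B"
  shows "moment_bound s q (R / \<rho>) ((1 + (1 + 2 * s / (a * \<kappa>)) ^ CARD('k)) * B)"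
  unfolding moment_bound_def
proof (intro allI impI)
  fix E :: "(real ^ 'k) set"
  assume E: "finite E" "E \<subseteq> cball 0 (R / \<rho>)" "\<forall>x\<in>E. \<forall>y\<in>E. x \<noteq> y \<longrightarrow> s \<le> dist x y"
  have lo: "0 < a * \<rho>" using a \<rho> by simp
  then have lo0: "0 \<le> a * \<rho>" by simp
  define G where "G \<xi> = (\<Sum>w\<in>set_pmf D. pmf D w * envelope (\<xi> v* fst w) ^ (2 * q))" for \<xi>
  define N where "N = {\<xi>\<in>E. (1 - d) * (rms D \<xi>)\<^sup>2 < (envelope \<xi>)\<^sup>2}"
  have N: "N \<subseteq> E" "finite N" "finite (E - N)" using E by (auto simp: N_def)
  have "(\<Sum>\<xi>\<in>N. envelope \<xi> ^ (2 * q)) \<le> (\<Sum>\<xi>\<in>N. 1 ^ q * G \<xi>)"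
    unfolding G_def using envelope_le_rms[OF D lo0 \<rho>(2)] by (intro sum_mono envelope_power_le[OF D lo0]) auto
  also have "\<dots> = (\<Sum>\<xi>\<in>N. G \<xi>)" by simp
  also have "\<dots> \<le> (1 + 2 * s / (a * \<rho> * (\<kappa> / \<rho>))) ^ CARD('k) * B"
    unfolding G_def
  proof (rule moment_transfer[OF D lo \<rho>(1) R s N(2)])
    show "\<kappa> / \<rho> \<le> dist x y" if "x \<in> N" "y \<in> N" "x \<noteq> y" for x y
    proof -
      have "s \<le> dist x y" using that E(3) N(1) by blast
      then have "\<kappa> \<le> \<rho> * dist x y" using sparse that by (simp add: N_def)
      then show ?thesis using \<rho> by (simp add: pos_divide_le_eq mult.commute)
    qed
  qed (use E N \<kappa> \<rho> in auto)
  also have "a * \<rho> * (\<kappa> / \<rho>) = a * \<kappa>" using \<rho> by simp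
  finally have 1: "(\<Sum>\<xi>\<in>N. envelope \<xi> ^ (2 * q)) \<le> (1 + 2 * s / (a * \<kappa>)) ^ CARD('k) * B" .
  have "(\<Sum>\<xi>\<in>E - N. envelope \<xi> ^ (2 * q)) \<le> (\<Sum>\<xi>\<in>E - N. (1 - d) ^ q * G \<xi>)"
    unfolding G_def using d by (intro sum_mono envelope_power_le[OF D lo0]) (auto simp: N_def)
  also have "\<dots> = (1 - d) ^ q * (\<Sum>\<xi>\<in>E - N. G \<xi>)"
    by (rule sum_distrib_left[symmetric])
  \<comment> \<open>These points are only \<open>s\<close>-separated, so the transfer factor grows
    with \<open>1 / \<rho>\<close>; the choice of \<open>q\<close> cancels it.\<close>
  also have "\<dots> \<le> (1 - d) ^ q * ((1 + 2 * s / (a * \<rho> * s)) ^ CARD('k) * B)"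
    unfolding G_def using E d s by (intro mult_left_mono moment_transfer[OF D lo \<rho>(1) R s N(3)]) auto
  also have "2 * s / (a * \<rho> * s) = 2 / (a * \<rho>)" using s by simp
  also have "(1 - d) ^ q * ((1 + 2 / (a * \<rho>)) ^ CARD('k) * B) \<le> 1 * B"
    unfolding mult.assoc[symmetric] using q B by (intro mult_right_mono)
  finally have 2: "(\<Sum>\<xi>\<in>E - N. envelope \<xi> ^ (2 * q)) \<le> B" by simp
  have "(\<Sum>\<xi>\<in>E. envelope \<xi> ^ (2 * q)) = (\<Sum>\<xi>\<in>E - N. envelope \<xi> ^ (2 * q)) + (\<Sum>\<xi>\<in>N. envelope \<xi> ^ (2 * q))"
    using E N by (intro sum.subset_diff)
  then show "(\<Sum>\<xi>\<in>E. envelope \<xi> ^ (2 * q)) \<le> (1 + (1 + 2 * s / (a * \<kappa>)) ^ CARD('k)) * B"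
    using 1 2 by (simp add: distrib_right)
qed

text \<open>The order of choices is essential: \<open>L\<close> comes from \<open>s\<close> and
  \<open>\<kappa>\<close>, then \<open>\<rho>\<close> with
  \<open>L \<le> (1 / \<rho>) powr \<epsilon>\<close>, then \<open>D\<close> and \<open>d\<close>,
  and \<open>q\<close> last. Each enlargement of the radius by \<open>1 / \<rho>\<close> then costs
  the factor \<open>L\<close>.\<close>

lemma moment_growth:
  assumes irr: "affinely_irreducible \<mu>" and \<epsilon>: "0 < \<epsilon>"
  obtains s q C where "0 < s" "0 < q" "0 < C" "\<And>R. 1 < R \<Longrightarrow> moment_bound s q R (C * R powr \<epsilon>)"
proof -
  obtain s \<kappa> \<rho>0 where s: "0 < s" and \<kappa>: "0 < \<kappa>" and \<rho>0: "0 < \<rho>0"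
    and fam: "\<And>\<rho>. 0 < \<rho> \<Longrightarrow> \<rho> \<le> 1 \<Longrightarrow> \<rho> \<le> \<rho>0 \<Longrightarrow> \<exists>D d. stationary_family \<mu> K (a * \<rho>) \<rho> D \<and> 0 < d \<and> d \<le> 1 \<and>
       (\<forall>\<xi> \<xi>'. (1 - d) * (rms D \<xi>)\<^sup>2 < (envelope \<xi>)\<^sup>2 \<longrightarrow> (1 - d) * (rms D \<xi>')\<^sup>2 < (envelope \<xi>')\<^sup>2 \<longrightarrow>
          s \<le> dist \<xi> \<xi>' \<longrightarrow> \<kappa> \<le> \<rho> * dist \<xi> \<xi>')"
    by (rule near_optimal_sparse[OF irr]) (rule that; assumption)
  define L where "L = 1 + (1 + 2 * s / (a * \<kappa>)) ^ CARD('k)"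
  have L: "1 < L" unfolding L_def using s \<kappa> a by (simp add: add_pos_pos)
  define \<rho> where "\<rho> = min (1 / 2) (min \<rho>0 (L powr (- (1 / \<epsilon>))))"
  have \<rho>: "0 < \<rho>" "\<rho> \<le> 1" "\<rho> < 1" "\<rho> \<le> \<rho>0" "\<rho> \<le> L powr (- (1 / \<epsilon>))"
    using \<rho>0 L by (auto simp: \<rho>_def)
  have L_le: "L \<le> (1 / \<rho>) powr \<epsilon>"
  proof -
    have "\<rho> powr \<epsilon> \<le> (L powr (- (1 / \<epsilon>))) powr \<epsilon>"
      using \<rho> \<epsilon> by (intro powr_mono2) auto
    also have "\<dots> = L powr (- 1)"
      unfolding powr_powr using \<epsilon> by simp
    also have "\<dots> = 1 / L"
      using L by (simp add: powr_minus_divide)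
    finally show ?thesis
      using L \<rho> by (simp add: powr_divide field_simps)
  qed
  obtain D d where D: "stationary_family \<mu> K (a * \<rho>) \<rho> D" and d: "0 < d" "d \<le> 1"
    and sparse: "\<forall>\<xi> \<xi>'. (1 - d) * (rms D \<xi>)\<^sup>2 < (envelope \<xi>)\<^sup>2 \<longrightarrow> (1 - d) * (rms D \<xi>')\<^sup>2 < (envelope \<xi>')\<^sup>2 \<longrightarrow>
          s \<le> dist \<xi> \<xi>' \<longrightarrow> \<kappa> \<le> \<rho> * dist \<xi> \<xi>'"
    using fam[OF \<rho>(1,2,4)] by (elim exE conjE) (rule that)
  define V where "V = (1 + 2 / (a * \<rho>)) ^ CARD('k)"
  have V: "0 < V" unfolding V_def using a \<rho> by (intro zero_less_power add_pos_pos) auto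
  obtain n where n: "(1 - d) ^ n < 1 / V"
    using real_arch_pow_inv[of "1 / V" "1 - d"] V d by auto
  \<comment> \<open>The successor ensures \<open>0 < q\<close>; the decay exponent is later obtained
    by dividing by \<open>q\<close>.\<close>
  define q where "q = Suc n"
  have "(1 - d) ^ q \<le> (1 - d) ^ n"
    unfolding q_def using d by (intro power_decreasing) auto
  then have "(1 - d) ^ q \<le> 1 / V" using n by simp
  then have q: "(1 - d) ^ q * V \<le> 1" using V by (simp add: pos_le_divide_eq)
  define M where "M = (1 + 2 / s) ^ CARD('k)"
  have M: "0 < M" unfolding M_def using s by (intro zero_less_power add_pos_pos) auto
  have iter: "moment_bound s q ((1 / \<rho>) ^ n) (L ^ n * M)" for n
  proof (induction n)
    case 0
    then show ?case using moment_bound_1[OF s] by (simp add: M_def)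
  next
    case (Suc n)
    have "moment_bound s q ((1 / \<rho>) ^ n / \<rho>) (L * (L ^ n * M))"
      unfolding L_def using M L q[unfolded V_def]
      by (intro moment_step[OF D \<rho>(1,2) d sparse s \<kappa> _ Suc[unfolded L_def]]) (auto simp: L_def)
    then show ?case by (simp add: mult_ac)
  qed
  have "moment_bound s q R (L * M * R powr \<epsilon>)" if R: "1 < R" for R
  proof -
    \<comment> \<open>By minimality \<open>R\<close> lies between consecutive powers of
      \<open>1 / \<rho>\<close>; rounding up costs one extra factor \<open>L\<close>, which goes
      into the constant.\<close>
    define n where "n = (LEAST n. R \<le> (1 / \<rho>) ^ n)"
    have "\<exists>n. R \<le> (1 / \<rho>) ^ n"
      using real_arch_pow[of "1 / \<rho>" R] \<rho> less_imp_le by auto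
    then have n: "R \<le> (1 / \<rho>) ^ n" unfolding n_def by (rule LeastI_ex)
    have "n \<noteq> 0" using n R by (intro notI) simp
    then obtain m where m: "n = Suc m" by (cases n) auto
    have "\<not> R \<le> (1 / \<rho>) ^ m"
      using not_less_Least[of m "\<lambda>n. R \<le> (1 / \<rho>) ^ n"] m unfolding n_def by simp
    then have m': "(1 / \<rho>) ^ m \<le> R" by simp
    have pow: "(y powr \<epsilon>) ^ m = (y ^ m) powr \<epsilon>" if "0 < y" for y :: real
      using that by (simp add: powr_powr mult.commute flip: powr_realpow)
    have "L ^ m \<le> ((1 / \<rho>) powr \<epsilon>) ^ m"
      using L_le L by (intro power_mono) auto
    also have "\<dots> = ((1 / \<rho>) ^ m) powr \<epsilon>"
      using \<rho> by (intro pow) simp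
    also have "\<dots> \<le> R powr \<epsilon>"
      using m' \<rho> \<epsilon> by (intro powr_mono2) auto
    finally have "L ^ n * M \<le> L * M * R powr \<epsilon>"
      using L M m by (simp add: mult_ac)
    moreover have "cball 0 R \<subseteq> (cball 0 ((1 / \<rho>) ^ n) :: (real ^ 'k) set)"
      using n by auto
    ultimately show ?thesis
      using iter[of n] unfolding moment_bound_def by (meson order_trans)
  qed
  then show ?thesis
    using s L M by (intro that[of s q "L * M"]) (auto simp: q_def)
qed

text \<open>Chebyshev's argument: the moment bound limits the cardinality of separated subsets of
  the level set, and hence its measure.\<close>

lemma irreducible_imp_sparse:
  assumes irr: "affinely_irreducible \<mu>"
  shows "fourier_decay_outside_sparse \<mu>"
  unfolding fourier_decay_outside_sparse_def
proof (intro allI impI)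
  fix \<epsilon> :: real assume \<epsilon>: "0 < \<epsilon>"
  then have "0 < \<epsilon> / 2" by simp
  from moment_growth[OF irr this] obtain s q C where s: "0 < s" and q: "0 < q" and C: "0 < C"
    and bound: "\<And>R. 1 < R \<Longrightarrow> moment_bound s q R (C * R powr (\<epsilon> / 2))" by blast
  \<comment> \<open>Makes each summand of the moment at least
    \<open>R powr (- (\<epsilon> / 2))\<close>; the growth \<open>R powr (\<epsilon> / 2)\<close> of
    the moment then gives the exponent \<open>\<epsilon>\<close>.\<close>
  define \<delta> where "\<delta> = \<epsilon> / (4 * q)"
  define V where "V = measure lebesgue (cball (0 :: real ^ 'k) s)"
  have V: "0 < V" unfolding V_def using s by (simp add: content_cball)
  have "emeasure lborel {\<xi>. R powr (- \<delta>) \<le> cmod (fourier_transform \<mu> \<xi>) \<and> norm \<xi> < R} \<le> ennreal (C * V * R powr \<epsilon>)"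
    if R: "1 < R" for R
  proof -
    let ?S = "{\<xi>. R powr (- \<delta>) \<le> cmod (fourier_transform \<mu> \<xi>) \<and> norm \<xi> < R}"
    have "emeasure lborel ?S \<le> ennreal (C * R powr \<epsilon> * measure lebesgue (cball (0 :: real ^ 'k) s))"
    proof (rule emeasure_le_separated_card[OF _ s])
      show "?S \<subseteq> cball 0 R" "0 \<le> R" using R by auto
      fix E assume E: "finite E" "E \<subseteq> ?S" "\<forall>x\<in>E. \<forall>y\<in>E. x \<noteq> y \<longrightarrow> s \<le> dist x y"
      have "(\<Sum>\<xi>\<in>E. R powr (- (\<epsilon> / 2))) \<le> (\<Sum>\<xi>\<in>E. envelope \<xi> ^ (2 * q))"
      proof (rule sum_mono)
        fix \<xi> assume "\<xi> \<in> E"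
        then have "R powr (- \<delta>) \<le> envelope \<xi>"
          using E(2) twisted_le_envelope_1[OF lip_1, of \<xi>] by (force simp: fourier_transform_eq_twisted)
        then have "(R powr (- \<delta>)) ^ (2 * q) \<le> envelope \<xi> ^ (2 * q)"
          by (intro power_mono) auto
        moreover have "(R powr (- \<delta>)) ^ (2 * q) = R powr (- (\<epsilon> / 2))"
          using R q by (simp add: powr_realpow[symmetric] powr_powr \<delta>_def)
        ultimately show "R powr (- (\<epsilon> / 2)) \<le> envelope \<xi> ^ (2 * q)" by simp
      qed
      also have "\<dots> \<le> C * R powr (\<epsilon> / 2)"
      proof -
        have "E \<subseteq> cball 0 R" using E(2) by auto
        then show ?thesis using bound[OF R] E(1,3) unfolding moment_bound_def by blast
      qed
      finally have "real (card E) * R powr (- (\<epsilon> / 2)) \<le> C * R powr (\<epsilon> / 2)" by simp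
      then have "real (card E) * R powr (- (\<epsilon> / 2)) * R powr (\<epsilon> / 2) \<le> C * R powr (\<epsilon> / 2) * R powr (\<epsilon> / 2)"
        by (intro mult_right_mono) auto
      then show "real (card E) \<le> C * R powr \<epsilon>"
        using R by (simp add: mult.assoc flip: powr_add)
    qed
    then show ?thesis by (simp add: V_def mult_ac)
  qed
  moreover have "0 < \<delta>" "0 < C * V" using \<epsilon> q C V by (auto simp: \<delta>_def)
  ultimately show "\<exists>\<delta>>0. \<exists>C>0. \<forall>R>1. emeasure lborel {\<xi>. R powr (- \<delta>) \<le> cmod (fourier_transform \<mu> \<xi>) \<and> norm \<xi> < R}
      \<le> ennreal (C * R powr \<epsilon>)"
    by blast
qed


section \<open>Measures charging a hyperplane\<close>

text \<open>The double sum is bounded below by the integral of the Fejer-type kernel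
  \<open>\<bar>\<Sum>j<n. e(j (v \<bullet> x - b))\<bar>\<^sup>2\<close>, which is nonnegative and equals \<open>n\<^sup>2\<close> on the hyperplane.\<close>
lemma hyperplane_mass_le:
  "real n ^ 2 * measure \<mu> {x. v \<bullet> x = b} \<le>
     (\<Sum>j<n. \<Sum>l<n. cmod (twisted (\<lambda>_. 1) ((real j - real l) *\<^sub>R v)))"
proof -
  define H where "H = {x. v \<bullet> x = b}"
  have H: "H \<in> events"
    unfolding H_def sets by (intro borel_closed closed_hyperplane)
  define F where "F x = (\<Sum>j<n. cis (- 2 * pi * (real j * (v \<bullet> x - b))))" for x
  define e where "e j l = cis (2 * pi * ((real j - real l) * b))" for j l
  define g where "g j l x = cis (- 2 * pi * (((real j - real l) *\<^sub>R v) \<bullet> x))" for j l x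
  have F_sq: "complex_of_real ((cmod (F x))\<^sup>2) = (\<Sum>j<n. \<Sum>l<n. e j l * g j l x)" for x
  proof -
    have "cis (- 2 * pi * (real j * (v \<bullet> x - b))) * cnj (cis (- 2 * pi * (real l * (v \<bullet> x - b)))) = e j l * g j l x" for j l
      unfolding e_def g_def cis_cnj cis_mult by (rule arg_cong[where f=cis]) (simp add: algebra_simps)
    then show ?thesis
      unfolding complex_norm_square F_def by (simp add: sum_product cnj_sum)
  qed
  have int_g: "integrable \<mu> (g j l)" for j l
    using twisted_integrand(3)[of "\<lambda>_. 1" 1 "(real j - real l) *\<^sub>R v"] by (simp add: g_def[abs_def])
  have g_twisted: "(LINT x|\<mu>. g j l x) = twisted (\<lambda>_. 1) ((real j - real l) *\<^sub>R v)" for j l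
    by (simp add: twisted_def g_def)
  have "integrable \<mu> (\<lambda>x. complex_of_real ((cmod (F x))\<^sup>2))"
    unfolding F_sq using int_g by (intro Bochner_Integration.integrable_sum integrable_mult_right)
  then have intF: "integrable \<mu> (\<lambda>x. (cmod (F x))\<^sup>2)"
    by (simp only: complex_of_real_integrable_eq)
  have "complex_of_real (LINT x|\<mu>. (cmod (F x))\<^sup>2) = (LINT x|\<mu>. complex_of_real ((cmod (F x))\<^sup>2))"
    by (rule integral_complex_of_real[symmetric])
  also have "\<dots> = (\<Sum>j<n. \<Sum>l<n. e j l * twisted (\<lambda>_. 1) ((real j - real l) *\<^sub>R v))"
    unfolding F_sq using int_g by (simp add: Bochner_Integration.integral_sum g_twisted)
  finally have eq: "complex_of_real (LINT x|\<mu>. (cmod (F x))\<^sup>2) =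
      (\<Sum>j<n. \<Sum>l<n. e j l * twisted (\<lambda>_. 1) ((real j - real l) *\<^sub>R v))" .
  have "real n ^ 2 * measure \<mu> H = (LINT x|\<mu>. real n ^ 2 * indicator H x)"
    using H by simp
  also have "\<dots> \<le> (LINT x|\<mu>. (cmod (F x))\<^sup>2)"
  proof (rule integral_mono[OF _ intF])
    show "integrable \<mu> (\<lambda>x. real n ^ 2 * indicator H x)"
      using H by (intro integrable_mult_right integrable_real_indicator) (auto simp: emeasure_eq_measure)
    show "real n ^ 2 * indicator H x \<le> (cmod (F x))\<^sup>2" for x
      by (cases "x \<in> H") (auto simp: H_def F_def)
  qed
  also have "\<dots> \<le> cmod (complex_of_real (LINT x|\<mu>. (cmod (F x))\<^sup>2))"
    by simp
  also have "\<dots> \<le> (\<Sum>j<n. \<Sum>l<n. cmod (e j l * twisted (\<lambda>_. 1) ((real j - real l) *\<^sub>R v)))"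
    unfolding eq by (intro order_trans[OF norm_sum] sum_mono norm_sum)
  also have "\<dots> = (\<Sum>j<n. \<Sum>l<n. cmod (twisted (\<lambda>_. 1) ((real j - real l) *\<^sub>R v)))"
    by (simp add: e_def norm_mult)
  finally show ?thesis by (simp add: H_def)
qed

text \<open>Averaging gives a row \<open>j\<close> whose coefficients sum to at least
  \<open>n * m\<close>. Those below \<open>m / 2\<close> contribute at most half of that, the others
  at most 1 each.\<close>

lemma many_large_coefficients:
  fixes n :: nat and v :: "real ^ 'k" and b :: real
  assumes "0 < n"
  defines "m \<equiv> measure \<mu> {x. v \<bullet> x = b}"
  obtains j J where "j < n" "J \<subseteq> {..<n}" "real n * m / 2 \<le> real (card J)"
    "\<And>l. l \<in> J \<Longrightarrow> m / 2 \<le> cmod (twisted (\<lambda>_. 1) ((real j - real l) *\<^sub>R v))"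
proof -
  define t where "t j l = cmod (twisted (\<lambda>_. 1) ((real j - real l) *\<^sub>R v))" for j l :: nat
  have t: "t j l \<le> 1" for j l
    unfolding t_def by (intro norm_twisted_le) auto
  have "\<exists>j<n. real n * m \<le> (\<Sum>l<n. t j l)"
  proof (rule ccontr)
    assume "\<not> ?thesis"
    then have "(\<Sum>j<n. \<Sum>l<n. t j l) < (\<Sum>j<n. real n * m)"
      using assms(1) by (intro sum_strict_mono) (auto simp: not_le)
    then show False
      using hyperplane_mass_le[of n v b] by (simp add: t_def m_def power2_eq_square)
  qed
  then obtain j where j: "j < n" "real n * m \<le> (\<Sum>l<n. t j l)" by blast
  define J where "J = {l\<in>{..<n}. m / 2 \<le> t j l}"
  have J: "J \<subseteq> {..<n}" by (auto simp: J_def)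
  have "(\<Sum>l<n. t j l) = (\<Sum>l\<in>{..<n} - J. t j l) + (\<Sum>l\<in>J. t j l)"
    using J by (intro sum.subset_diff) auto
  also have "\<dots> \<le> real (card ({..<n} - J)) * (m / 2) + real (card J) * 1"
    using t by (intro add_mono sum_bounded_above) (auto simp: J_def)
  also have "\<dots> \<le> real n * (m / 2) + real (card J)"
  proof -
    have "card ({..<n} - J) \<le> card {..<n}" by (intro card_mono) auto
    then show ?thesis by (intro add_mono mult_right_mono) (auto simp: m_def)
  qed
  finally have "real n * m / 2 \<le> real (card J)" using j by simp
  then show ?thesis
    using j J by (intro that[of j J]) (auto simp: J_def t_def)
qed

lemma measurable_level_set:
  "{\<xi>. c \<le> cmod (fourier_transform \<mu> \<xi>) \<and> norm \<xi> < R} \<in> sets lborel"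
proof -
  have "closed {\<xi>. c \<le> cmod (twisted (\<lambda>_. 1) \<xi>)}"
    by (intro closed_Collect_le continuous_intros continuous_on_twisted_1)
  then have "{\<xi>. c \<le> cmod (twisted (\<lambda>_. 1) \<xi>)} \<inter> ball 0 R \<in> sets borel"
    by (intro sets.Int borel_closed borel_open) auto
  moreover have "{\<xi>. c \<le> cmod (fourier_transform \<mu> \<xi>) \<and> norm \<xi> < R} = {\<xi>. c \<le> cmod (twisted (\<lambda>_. 1) \<xi>)} \<inter> ball 0 R"
    by (auto simp: fourier_transform_eq_twisted)
  ultimately show ?thesis by simp
qed

text \<open>By its Lipschitz bound the transform stays large on a ball around each multiple of
  \<open>v\<close> with a large coefficient. These balls are disjoint, and their number grows
  linearly in \<open>n\<close>.\<close>

lemma level_set_large: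
  assumes v: "v \<noteq> 0" and m: "0 < measure \<mu> {x. v \<bullet> x = b}"
  obtains c c' where "0 < c" "0 < c'"
    "\<And>n. 0 < n \<Longrightarrow> ennreal (c * real n) \<le>
      emeasure lborel {\<xi>. c' \<le> cmod (fourier_transform \<mu> \<xi>) \<and> norm \<xi> < real (Suc n) * norm v}"
proof -
  define m where "m = measure \<mu> {x. v \<bullet> x = b}"
  have m0: "0 < m" using m by (simp add: m_def)
  \<comment> \<open>The first bound makes balls about different multiples of \<open>v\<close>
    disjoint; the second keeps the loss \<open>2 * pi * K * \<sigma>\<close> at most
    \<open>m / 4\<close>, half of the guaranteed size.\<close>
  define \<sigma> where "\<sigma> = min (norm v / 2) (m / (8 * pi * K))"
  have \<sigma>: "0 < \<sigma>" "\<sigma> \<le> norm v / 2" "\<sigma> \<le> m / (8 * pi * K)"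
    using v m0 K by (auto simp: \<sigma>_def)
  then have \<sigma>K: "2 * pi * K * \<sigma> \<le> m / 4"
    using K by (simp add: field_simps)
  define V where "V = measure lborel (ball (0 :: real ^ 'k) \<sigma>)"
  have V: "0 < V" unfolding V_def using \<sigma>(1) by (rule content_ball_pos)
  have emV: "emeasure lborel (ball (c :: real ^ 'k) \<sigma>) = ennreal V" for c
    using \<sigma>(1) by (simp add: V_def emeasure_ball measure_def)
  have "ennreal (m / 2 * V * real n) \<le>
      emeasure lborel {\<xi>. m / 4 \<le> cmod (fourier_transform \<mu> \<xi>) \<and> norm \<xi> < real (Suc n) * norm v}"
    (is "_ \<le> emeasure lborel ?S") if n: "0 < n" for n
  proof -
    obtain j J where j: "j < n" and J: "J \<subseteq> {..<n}" and card: "real n * m / 2 \<le> real (card J)"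
      and large: "\<And>l. l \<in> J \<Longrightarrow> m / 2 \<le> cmod (twisted (\<lambda>_. 1) ((real j - real l) *\<^sub>R v))"
      using many_large_coefficients[OF n, of v b] unfolding m_def by metis
    have fin: "finite J" using J finite_subset by blast
    define P where "P l = (real j - real l) *\<^sub>R v" for l
    have disj: "disjoint_family_on (\<lambda>l. ball (P l) \<sigma>) J"
    proof (unfold disjoint_family_on_def, intro ballI impI)
      fix l l' :: nat assume "l \<noteq> l'"
      then have "1 \<le> \<bar>real l' - real l\<bar>" by linarith
      then have "1 * norm v \<le> \<bar>real l' - real l\<bar> * norm v" by (intro mult_right_mono) auto
      also have "\<dots> = dist (P l) (P l')"
        unfolding P_def dist_norm scaleR_left_diff_distrib[symmetric] by simp
      finally show "ball (P l) \<sigma> \<inter> ball (P l') \<sigma> = {}"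
        using \<sigma> by (intro disjoint_ballI) auto
    qed
    have "ennreal (m / 2 * V * real n) \<le> ennreal (real (card J) * V)"
      using card V by (intro ennreal_leI) (simp add: mult_right_mono mult.commute mult.left_commute field_simps)
    also have "\<dots> = (\<Sum>l\<in>J. emeasure lborel (ball (P l) \<sigma>))"
      using V by (simp add: emV ennreal_mult ennreal_of_nat_eq_real_of_nat)
    also have "\<dots> = emeasure lborel (\<Union>l\<in>J. ball (P l) \<sigma>)"
      using fin disj by (intro sum_emeasure) auto
    also have "\<dots> \<le> emeasure lborel ?S"
    proof (rule emeasure_mono[OF _ measurable_level_set])
      show "(\<Union>l\<in>J. ball (P l) \<sigma>) \<subseteq> ?S"
      proof safe
        fix l y assume l: "l \<in> J" and y: "y \<in> ball (P l) \<sigma>"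
        have d: "norm (P l - y) \<le> \<sigma>" using y by (simp add: dist_norm)
        have "cmod (twisted (\<lambda>_. 1) (P l) - twisted (\<lambda>_. 1) y) \<le> 2 * pi * K * norm (P l - y)"
          by (rule norm_twisted_1_diff_le)
        also have "\<dots> \<le> 2 * pi * K * \<sigma>"
          using d K by (intro mult_left_mono) auto
        finally have "cmod (twisted (\<lambda>_. 1) (P l) - twisted (\<lambda>_. 1) y) \<le> m / 4"
          using \<sigma>K by linarith
        then show "m / 4 \<le> cmod (fourier_transform \<mu> y)"
          using large[OF l] norm_triangle_sub[of "twisted (\<lambda>_. 1) (P l)" "twisted (\<lambda>_. 1) y"]
          by (simp add: fourier_transform_eq_twisted P_def)
        have "l < n" using l J by auto
        then have "\<bar>real j - real l\<bar> \<le> real n" using j by linarith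
        then have "norm (P l) \<le> real n * norm v"
          by (simp add: P_def mult_right_mono)
        moreover have "norm y \<le> norm (P l) + norm (P l - y)"
          by (metis norm_triangle_sub norm_minus_commute)
        moreover have "0 < norm v" using v by simp
        ultimately have "norm y < real n * norm v + norm v"
          using d \<sigma>(2) by linarith
        then show "norm y < real (Suc n) * norm v"
          by (simp add: distrib_right)
      qed
    qed
    finally show ?thesis .
  qed
  then show ?thesis
    using m0 V by (intro that[of "m / 2 * V" "m / 4"]) auto
qed

text \<open>A charged hyperplane makes a level set at fixed height grow at least linearly with the
  radius, while sparseness allows only a small power.\<close>

lemma sparse_imp_irreducible:
  assumes sparse: "fourier_decay_outside_sparse \<mu>"
  shows "affinely_irreducible \<mu>"
  unfolding affinely_irreducible_def
proof (intro allI impI)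
  fix v :: "real ^ 'k" and b assume v: "v \<noteq> 0"
  show "emeasure \<mu> {x. v \<bullet> x = b} = 0"
  proof (rule ccontr)
    assume "emeasure \<mu> {x. v \<bullet> x = b} \<noteq> 0"
    then have "0 < measure \<mu> {x. v \<bullet> x = b}"
      by (simp add: emeasure_eq_measure zero_less_measure_iff)
    from level_set_large[OF v this] obtain c c' where c: "0 < c" "0 < c'"
      and large: "\<And>n. 0 < n \<Longrightarrow> ennreal (c * real n) \<le>
        emeasure lborel {\<xi>. c' \<le> cmod (fourier_transform \<mu> \<xi>) \<and> norm \<xi> < real (Suc n) * norm v}"
      by blast
    \<comment> \<open>Any exponent below 1 contradicts linear growth; \<open>1 / 2\<close> is one
      choice.\<close>
    obtain \<delta> C where \<delta>: "0 < \<delta>" and C: "0 < C" and small: "\<And>R. 1 < R \<Longrightarrow>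
        emeasure lborel {\<xi>. R powr (- \<delta>) \<le> cmod (fourier_transform \<mu> \<xi>) \<and> norm \<xi> < R} \<le> ennreal (C * R powr (1 / 2))"
      using sparse[unfolded fourier_decay_outside_sparse_def, rule_format, of "1 / 2"] by auto
    define R where "R n = real (Suc n) * norm v" for n
    have R: "filterlim R at_top sequentially"
      unfolding R_def
      by (intro filterlim_at_top_mult_tendsto_pos[OF tendsto_const] filterlim_compose[OF filterlim_real_sequentially filterlim_Suc])
        (use v in auto)
    have "eventually (\<lambda>n. R n powr (- \<delta>) < c') sequentially"
      using tendsto_neg_powr[OF _ R, of "- \<delta>"] \<delta> c by (intro order_tendstoD(2)) auto
    \<comment> \<open>With this threshold the upper estimate drops below
      \<open>c * real (Suc n) / 2\<close>, which is at most \<open>c * real n\<close> once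
      \<open>n\<close> is positive.\<close>
    moreover have "eventually (\<lambda>n. R n powr (- (1 / 2)) < c / (2 * norm v * C)) sequentially"
      using tendsto_neg_powr[OF _ R, of "- (1 / 2)"] v c C by (intro order_tendstoD(2)) auto
    moreover have "eventually (\<lambda>n. 1 < R n) sequentially"
      using R by (simp add: filterlim_at_top_dense)
    moreover have "eventually (\<lambda>n. 0 < n) sequentially"
      by (rule eventually_gt_at_top)
    ultimately have "eventually (\<lambda>n. False) sequentially"
    proof eventually_elim
      case (elim n)
      have "ennreal (c * real n) \<le> emeasure lborel {\<xi>. c' \<le> cmod (fourier_transform \<mu> \<xi>) \<and> norm \<xi> < R n}"
        unfolding R_def using elim by (intro large)
      also have "\<dots> \<le> emeasure lborel {\<xi>. R n powr (- \<delta>) \<le> cmod (fourier_transform \<mu> \<xi>) \<and> norm \<xi> < R n}"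
        using elim by (intro emeasure_mono measurable_level_set) auto
      also have "\<dots> \<le> ennreal (C * R n powr (1 / 2))"
        using elim by (intro small)
      finally have "c * real n \<le> C * R n powr (1 / 2)"
        using C by (simp add: ennreal_le_iff)
      also have "R n powr (1 / 2) = R n powr (- (1 / 2)) * R n"
        using elim by (simp add: powr_minus_divide powr_half_sqrt real_div_sqrt field_simps)
      also have "C * (R n powr (- (1 / 2)) * R n) < C * (c / (2 * norm v * C) * R n)"
        using elim C by (intro mult_strict_left_mono mult_strict_right_mono) auto
      also have "\<dots> = c * real (Suc n) / 2"
        using C v by (simp add: R_def field_simps)
      also have "\<dots> \<le> c * real n"
        using elim c by (simp add: field_simps)
      finally show False by simp
    qed
    then show False by simp
  qed
qed

end

section \<open>Self-similar measures\<close>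

theorem theorem3p10:
  fixes \<mu> :: "(real ^ 'k) measure"
  assumes "self_similar_measure \<mu>"
  shows "fourier_decay_outside_sparse \<mu> \<longleftrightarrow> affinely_irreducible \<mu>"
proof -
  from assms have "prob_space \<mu>" "sets \<mu> = sets borel"
    by (auto simp: self_similar_measure_def)
  moreover obtain K a where "1 \<le> K" "0 < a" "a \<le> 1" "AE x in \<mu>. norm x \<le> K"
    "\<And>\<rho>. 0 < \<rho> \<Longrightarrow> \<rho> \<le> 1 \<Longrightarrow> \<exists>D. stationary_family \<mu> K (a * \<rho>) \<rho> D"
    using self_similar_measure_stationary_family[OF assms] by blast
  ultimately interpret multiscale \<mu> K a
    by (rule multiscale.intro)
  show ?thesis
    using irreducible_imp_sparse sparse_imp_irreducible by blast
qed

end
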